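(* Let $X$ be singular, let $i:Z=\mathrm{Sing}(X)\hookrightarrow X$ and $j:U=X_{\mathrm{reg}}\hookrightarrow X$ be the singular locus and its regular open complement (satisfying the recollement axioms), and let $C$ be a characteristic theory with values in $A\in\mathcal C(X)$ providing classes $C(X)$ and $C^{\mathrm{vir}}(X)$ with $j^*C^{\mathrm{vir}}(X)=j^*C(X)$. Then the Milnor localisation torsor $\mathfrak{Mil}^C_Z(X)$ is nonempty and is a torsor under the secondary boundary group $$G^C_Z(X)=\mathrm{im}\bigl(\delta:H^{*-1}(U;j^*A)\to H^*_Z(X;A)\bigr).$$ Equivalently, if $\widetilde\Delta_1,\widetilde\Delta_2\in\mathfrak{Mil}^C_Z(X)$, then their difference is a unique element of $G^C_Z(X)$.
   Context: Setting: to each space $X$ is attached a stable triangulated category $\mathcal C(X)$ with a symmetric monoidal structure $(\otimes,\mathbf 1_X)$. Each morphism $f$ has exact functors $f^*\dashv f_*$ with $f^*$ symmetric monoidal. Recollement axioms for a closed immersion $i:Z\hookrightarrow X$ with open complement $j:U\hookrightarrow X$: adjunctions $i^*\dashv i_*\dashv i^!$, $j_!\dashv j^*\dashv j_*$; $i_*,j_!$ fully faithful; $j^*i_*=0$, $i^*j_!=0$; functorial distinguished triangles $j_!j^*M\to M\to i_*i^*M\xrightarrow{+1}$, $i_*i^!M\to M\to j_*j^*M\xrightarrow{+1}$. Notation: $H^d(X;A)=\mathrm{Hom}(\mathbf 1_X,A[d])$; $H^d_Z(X;A)=\mathrm{Hom}(\mathbf 1_X,i_*i^!A[d])$; $\mathrm{forg}:H_Z^d(X;A)\to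 H^d(X;A)$ is induced by the counit $i_*i^!A\to A$. The localisation long exact sequence is $\cdots\to H_Z^d(X;A)\xrightarrow{\mathrm{forg}}H^d(X;A)\xrightarrow{j^*}H^d(U;j^*A)\xrightarrow{\delta}H_Z^{d+1}(X;A)\to\cdots$. An asterisk denotes the relevant (graded) degrees. Characteristic theory $C$ with values in a coefficient object $A$: it provides a functorial class $C(X)\in H^*(X;A)$ and a virtual, expected, or Fulton-type class $C^{\mathrm{vir}}(X)\in H^*(X;A)$; only these two classes and their agreement on $U$ are used. The defect is $\Delta_C(X)=C^{\mathrm{vir}}(X)-C(X)$, so $j^*\Delta_C(X)=0$. The Milnor localisation torsor is $$\mathfrak{Mil}^C_Z(X)=\{\widetilde\Delta\in H^*_Z(X;A)\mid\mathrm{forg}(\widetilde\Delta)=\Delta_C(X)\}.$$ *)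

theory Defs
  imports
    "HOL-Analysis.Abstract_Topology"
    "HOL-Algebra.Product_Groups"
    "HOL-Algebra.Group_Action"
begin

section \<open>Categories, functors, adjunctions\<close>

record ('o, 'm) category =
  obj :: "'o set"
  arr :: "'m set"
  src :: "'m \<Rightarrow> 'o"
  tgt :: "'m \<Rightarrow> 'o"
  idn :: "'o \<Rightarrow> 'm"
  cmp :: "'m \<Rightarrow> 'm \<Rightarrow> 'm"  (infixr \<open>\<cdot>\<index>\<close> 70)

definition Hom :: "('o, 'm, 'z) category_scheme \<Rightarrow> 'o \<Rightarrow> 'o \<Rightarrow> 'm set"
  where "Hom C a b = {f \<in> arr C. src C f = a \<and> tgt C f = b}"

locale category =
  fixes C :: "('o, 'm, 'z) category_scheme" (structure)
  assumes src_obj: "f \<in> arr C \<Longrightarrow> src C f \<in> obj C"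
    and tgt_obj: "f \<in> arr C \<Longrightarrow> tgt C f \<in> obj C"
    and idn_Hom: "a \<in> obj C \<Longrightarrow> idn C a \<in> Hom C a a"
    and cmp_Hom: "\<lbrakk>f \<in> Hom C a b; g \<in> Hom C b c\<rbrakk> \<Longrightarrow> g \<cdot> f \<in> Hom C a c"
    and cmp_idn_right: "f \<in> Hom C a b \<Longrightarrow> f \<cdot> idn C a = f"
    and cmp_idn_left: "f \<in> Hom C a b \<Longrightarrow> idn C b \<cdot> f = f"
    and cmp_assoc: "\<lbrakk>f \<in> Hom C a b; g \<in> Hom C b c; h \<in> Hom C c d\<rbrakk>
      \<Longrightarrow> (h \<cdot> g) \<cdot> f = h \<cdot> (g \<cdot> f)"

definition inverse_arrows :: "('o, 'm, 'z) category_scheme \<Rightarrow> 'm \<Rightarrow> 'm \<Rightarrow> bool"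
  where "inverse_arrows C f g \<longleftrightarrow>
    f \<in> arr C \<and> g \<in> Hom C (tgt C f) (src C f) \<and>
    g \<cdot>\<^bsub>C\<^esub> f = idn C (src C f) \<and> f \<cdot>\<^bsub>C\<^esub> g = idn C (tgt C f)"

definition iso_arrow :: "('o, 'm, 'z) category_scheme \<Rightarrow> 'm \<Rightarrow> bool"
  where "iso_arrow C f \<longleftrightarrow> (\<exists>g. inverse_arrows C f g)"

definition inv_arrow :: "('o, 'm, 'z) category_scheme \<Rightarrow> 'm \<Rightarrow> 'm"
  where "inv_arrow C f = (THE g. inverse_arrows C f g)"

definition zero_object :: "('o, 'm, 'z) category_scheme \<Rightarrow> 'o \<Rightarrow> bool"
  where "zero_object C z \<longleftrightarrow>
    z \<in> obj C \<and> (\<forall>a \<in> obj C. (\<exists>!f. f \<in> Hom C a z) \<and> (\<exists>!f. f \<in> Hom C z a))"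

record ('o, 'm, 'p, 'n) func =
  fob :: "'o \<Rightarrow> 'p"
  far :: "'m \<Rightarrow> 'n"

locale cat_functor = dom: category C + cod: category D
  for C :: "('o, 'm, 'y) category_scheme" and D :: "('p, 'n, 'z) category_scheme" +
  fixes F :: "('o, 'm, 'p, 'n, 'w) func_scheme"
  assumes fob_obj: "a \<in> obj C \<Longrightarrow> fob F a \<in> obj D"
    and far_Hom: "f \<in> Hom C a b \<Longrightarrow> far F f \<in> Hom D (fob F a) (fob F b)"
    and far_idn: "a \<in> obj C \<Longrightarrow> far F (idn C a) = idn D (fob F a)"
    and far_cmp: "\<lbrakk>f \<in> Hom C a b; g \<in> Hom C b c\<rbrakk>
      \<Longrightarrow> far F (g \<cdot>\<^bsub>C\<^esub> f) = far F g \<cdot>\<^bsub>D\<^esub> far F f"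

definition id_func :: "('o, 'm, 'o, 'm) func"
  where "id_func = \<lparr>fob = (\<lambda>a. a), far = (\<lambda>f. f)\<rparr>"

definition comp_func ::
    "('p, 'n, 'q, 'k, 'y) func_scheme \<Rightarrow> ('o, 'm, 'p, 'n, 'z) func_scheme \<Rightarrow> ('o, 'm, 'q, 'k) func"
    (infixr \<open>\<circ>\<^sub>F\<close> 55)
  where "G \<circ>\<^sub>F F = \<lparr>fob = (\<lambda>a. fob G (fob F a)), far = (\<lambda>f. far G (far F f))\<rparr>"

definition fully_faithful ::
    "('o, 'm, 'y) category_scheme \<Rightarrow> ('p, 'n, 'z) category_scheme \<Rightarrow>
      ('o, 'm, 'p, 'n, 'w) func_scheme \<Rightarrow> bool"
  where "fully_faithful C D F \<longleftrightarrow>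
    (\<forall>a \<in> obj C. \<forall>b \<in> obj C. bij_betw (far F) (Hom C a b) (Hom D (fob F a) (fob F b)))"

definition nat_trans ::
    "('o, 'm, 'y) category_scheme \<Rightarrow> ('p, 'n, 'z) category_scheme \<Rightarrow>
      ('o, 'm, 'p, 'n, 'v) func_scheme \<Rightarrow> ('o, 'm, 'p, 'n, 'w) func_scheme \<Rightarrow> ('o \<Rightarrow> 'n) \<Rightarrow> bool"
  where "nat_trans C D F G \<tau> \<longleftrightarrow>
    (\<forall>a \<in> obj C. \<tau> a \<in> Hom D (fob F a) (fob G a)) \<and>
    (\<forall>a b. \<forall>f \<in> Hom C a b. far G f \<cdot>\<^bsub>D\<^esub> \<tau> a = \<tau> b \<cdot>\<^bsub>D\<^esub> far F f)"

text \<open>\<open>L\<close> is left adjoint to \<open>R\<close>, with unit \<open>\<eta>\<close> and counit \<open>\<epsilon>\<close>.\<close>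

locale adjunction = left: cat_functor C D L + right: cat_functor D C R
  for C :: "('o, 'm, 'y) category_scheme" and D :: "('p, 'n, 'z) category_scheme"
    and L :: "('o, 'm, 'p, 'n, 'v) func_scheme" and R :: "('p, 'n, 'o, 'm, 'w) func_scheme" +
  fixes \<eta> :: "'o \<Rightarrow> 'm" and \<epsilon> :: "'p \<Rightarrow> 'n"
  assumes unit_natural: "nat_trans C C id_func (R \<circ>\<^sub>F L) \<eta>"
    and counit_natural: "nat_trans D D (L \<circ>\<^sub>F R) id_func \<epsilon>"
    and triangle_left: "a \<in> obj C \<Longrightarrow> \<epsilon> (fob L a) \<cdot>\<^bsub>D\<^esub> far L (\<eta> a) = idn D (fob L a)"
    and triangle_right: "b \<in> obj D \<Longrightarrow> far R (\<epsilon> b) \<cdot>\<^bsub>C\<^esub> \<eta> (fob R b) = idn C (fob R b)"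


section \<open>Additive and triangulated categories\<close>

record ('o, 'm) add_category = "('o, 'm) category" +
  add :: "'m \<Rightarrow> 'm \<Rightarrow> 'm"  (infixl \<open>\<boxplus>\<index>\<close> 65)
  zer :: "'o \<Rightarrow> 'o \<Rightarrow> 'm"

text \<open>The abelian group \<open>Hom C a b\<close>, in the multiplicative notation of \<open>HOL-Algebra\<close>: its
  product \<open>\<otimes>\<close> is the addition of arrows and its \<open>\<one>\<close> is the zero arrow.\<close>

definition Hom_group :: "('o, 'm, 'z) add_category_scheme \<Rightarrow> 'o \<Rightarrow> 'o \<Rightarrow> 'm monoid"
  where "Hom_group C a b = \<lparr>carrier = Hom C a b, mult = add C, one = zer C a b\<rparr>"

definition neg :: "('o, 'm, 'z) add_category_scheme \<Rightarrow> 'm \<Rightarrow> 'm"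
  where "neg C f = inv\<^bsub>Hom_group C (src C f) (tgt C f)\<^esub> f"

locale additive_category = category C
  for C :: "('o, 'm, 'z) add_category_scheme" (structure) +
  assumes Hom_comm_group: "\<lbrakk>a \<in> obj C; b \<in> obj C\<rbrakk> \<Longrightarrow> comm_group (Hom_group C a b)"
    and cmp_add_left: "\<lbrakk>f \<in> Hom C a b; g \<in> Hom C b c; g' \<in> Hom C b c\<rbrakk>
      \<Longrightarrow> (g \<boxplus> g') \<cdot> f = (g \<cdot> f) \<boxplus> (g' \<cdot> f)"
    and cmp_add_right: "\<lbrakk>f \<in> Hom C a b; f' \<in> Hom C a b; g \<in> Hom C b c\<rbrakk>
      \<Longrightarrow> g \<cdot> (f \<boxplus> f') = (g \<cdot> f) \<boxplus> (g \<cdot> f')"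
    and ex_zero_object: "\<exists>z. zero_object C z"
    and ex_biproduct: "\<lbrakk>a \<in> obj C; b \<in> obj C\<rbrakk> \<Longrightarrow>
      \<exists>s \<in> obj C. \<exists>p \<in> Hom C s a. \<exists>q \<in> Hom C s b. \<exists>k \<in> Hom C a s. \<exists>l \<in> Hom C b s.
        p \<cdot> k = idn C a \<and> q \<cdot> l = idn C b \<and> p \<cdot> l = zer C b a \<and> q \<cdot> k = zer C a b \<and>
        (k \<cdot> p) \<boxplus> (l \<cdot> q) = idn C s"

locale additive_functor = cat_functor C D F + dom: additive_category C + cod: additive_category D
  for C :: "('o, 'm, 'y) add_category_scheme" and D :: "('p, 'n, 'z) add_category_scheme"
    and F :: "('o, 'm, 'p, 'n, 'w) func_scheme" +
  assumes far_add: "\<lbrakk>f \<in> Hom C a b; g \<in> Hom C a b\<rbrakk>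
    \<Longrightarrow> far F (f \<boxplus>\<^bsub>C\<^esub> g) = far F f \<boxplus>\<^bsub>D\<^esub> far F g"

text \<open>As usual the translations \<open>[n]\<close>, for integers \<open>n\<close>, form a strict action of the integers by
  additive functors.  The set \<open>dtri\<close> consists of the distinguished triangles
  \<open>x \<rightarrow> y \<rightarrow> z \<rightarrow> x[1]\<close>, each given by its three arrows.\<close>

record ('o, 'm) tri_category = "('o, 'm) add_category" +
  sho :: "int \<Rightarrow> 'o \<Rightarrow> 'o"
  sha :: "int \<Rightarrow> 'm \<Rightarrow> 'm"
  dtri :: "('m \<times> 'm \<times> 'm) set"

definition shift :: "('o, 'm, 'z) tri_category_scheme \<Rightarrow> int \<Rightarrow> ('o, 'm, 'o, 'm) func"
  where "shift C n = \<lparr>fob = sho C n, far = sha C n\<rparr>"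

definition triangle ::
    "('o, 'm, 'z) tri_category_scheme \<Rightarrow> 'o \<Rightarrow> 'o \<Rightarrow> 'o \<Rightarrow> 'm \<Rightarrow> 'm \<Rightarrow> 'm \<Rightarrow> bool"
  where "triangle C x y z f g h \<longleftrightarrow>
    f \<in> Hom C x y \<and> g \<in> Hom C y z \<and> h \<in> Hom C z (sho C 1 x)"

definition triangle_map ::
    "('o, 'm, 'z) tri_category_scheme \<Rightarrow> 'm \<times> 'm \<times> 'm \<Rightarrow> 'm \<times> 'm \<times> 'm \<Rightarrow>
      'm \<Rightarrow> 'm \<Rightarrow> 'm \<Rightarrow> bool"
  where "triangle_map C = (\<lambda>(f, g, h) (f', g', h') a b c.
    a \<in> Hom C (src C f) (src C f') \<and>
    b \<in> Hom C (src C g) (src C g') \<and>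
    c \<in> Hom C (src C h) (src C h') \<and>
    b \<cdot>\<^bsub>C\<^esub> f = f' \<cdot>\<^bsub>C\<^esub> a \<and> c \<cdot>\<^bsub>C\<^esub> g = g' \<cdot>\<^bsub>C\<^esub> b \<and> sha C 1 a \<cdot>\<^bsub>C\<^esub> h = h' \<cdot>\<^bsub>C\<^esub> c)"

locale triangulated_category = additive_category C
  for C :: "('o, 'm, 'z) tri_category_scheme" (structure) +
  assumes shift_additive: "additive_functor C C (shift C n)"
    and sho_zero: "a \<in> obj C \<Longrightarrow> sho C 0 a = a"
    and sha_zero: "f \<in> arr C \<Longrightarrow> sha C 0 f = f"
    and sho_add: "a \<in> obj C \<Longrightarrow> sho C (m + n) a = sho C m (sho C n a)"
    and sha_add: "f \<in> arr C \<Longrightarrow> sha C (m + n) f = sha C m (sha C n f)"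
    and dtri_triangle: "(f, g, h) \<in> dtri C \<Longrightarrow> \<exists>x y z. triangle C x y z f g h"
    and dtri_iso: "\<lbrakk>(f, g, h) \<in> dtri C; triangle C x y z f' g' h';
        triangle_map C (f, g, h) (f', g', h') u v w;
        iso_arrow C u; iso_arrow C v; iso_arrow C w\<rbrakk> \<Longrightarrow> (f', g', h') \<in> dtri C"
    and TR1_idn: "\<lbrakk>x \<in> obj C; zero_object C z\<rbrakk>
      \<Longrightarrow> (idn C x, zer C x z, zer C z (sho C 1 x)) \<in> dtri C"
    and TR1_cone: "f \<in> arr C \<Longrightarrow> \<exists>g h. (f, g, h) \<in> dtri C"
    and TR2: "triangle C x y z f g h
      \<Longrightarrow> (f, g, h) \<in> dtri C \<longleftrightarrow> (g, h, neg C (sha C 1 f)) \<in> dtri C"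
    and TR3: "\<lbrakk>(f, g, h) \<in> dtri C; (f', g', h') \<in> dtri C;
        u \<in> Hom C (src C f) (src C f'); v \<in> Hom C (tgt C f) (tgt C f');
        v \<cdot> f = f' \<cdot> u\<rbrakk> \<Longrightarrow> \<exists>w. triangle_map C (f, g, h) (f', g', h') u v w"
    and TR4: "\<lbrakk>f \<in> Hom C x y; g \<in> Hom C y z;
        (f, p\<^sub>1, d\<^sub>1) \<in> dtri C; (g \<cdot> f, p\<^sub>2, d\<^sub>2) \<in> dtri C; (g, p\<^sub>3, d\<^sub>3) \<in> dtri C\<rbrakk>
      \<Longrightarrow> \<exists>a b. (a, b, sha C 1 p\<^sub>1 \<cdot> d\<^sub>3) \<in> dtri C \<and>
            triangle_map C (f, p\<^sub>1, d\<^sub>1) (g \<cdot> f, p\<^sub>2, d\<^sub>2) (idn C x) g a \<and>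
            triangle_map C (g \<cdot> f, p\<^sub>2, d\<^sub>2) (g, p\<^sub>3, d\<^sub>3) f (idn C z) b"

text \<open>An exact functor \<open>F\<close> comes with natural isomorphisms \<open>shc F d a : F(a[d]) \<rightarrow> F(a)[d]\<close>.  They
  are all determined by those for \<open>d = 1\<close>, through the cocycle condition.\<close>

record ('o, 'm, 'p, 'n) ex_func = "('o, 'm, 'p, 'n) func" +
  shc :: "int \<Rightarrow> 'o \<Rightarrow> 'n"

locale exact_functor = additive_functor C D F +
    dom: triangulated_category C + cod: triangulated_category D
  for C :: "('o, 'm, 'y) tri_category_scheme" and D :: "('p, 'n, 'z) tri_category_scheme"
    and F :: "('o, 'm, 'p, 'n, 'w) ex_func_scheme" +
  assumes shc_natural: "nat_trans C D (F \<circ>\<^sub>F shift C d) (shift D d \<circ>\<^sub>F F) (shc F d)"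
    and shc_iso: "a \<in> obj C \<Longrightarrow> iso_arrow D (shc F d a)"
    and shc_zero: "a \<in> obj C \<Longrightarrow> shc F 0 a = idn D (fob F a)"
    and shc_add: "a \<in> obj C
      \<Longrightarrow> shc F (d + e) a = sha D d (shc F e a) \<cdot>\<^bsub>D\<^esub> shc F d (sho C e a)"
    and far_dtri: "(f, g, h) \<in> dtri C
      \<Longrightarrow> (far F f, far F g, shc F 1 (src C f) \<cdot>\<^bsub>D\<^esub> far F h) \<in> dtri D"


section \<open>Symmetric monoidal structures\<close>

record ('o, 'm) tt_category = "('o, 'm) tri_category" +
  tno :: "'o \<Rightarrow> 'o \<Rightarrow> 'o"
  tna :: "'m \<Rightarrow> 'm \<Rightarrow> 'm"
  tunit :: "'o"
  assoc :: "'o \<Rightarrow> 'o \<Rightarrow> 'o \<Rightarrow> 'm"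
  lunit :: "'o \<Rightarrow> 'm"
  runit :: "'o \<Rightarrow> 'm"
  braid :: "'o \<Rightarrow> 'o \<Rightarrow> 'm"

locale symmetric_monoidal_category = category C
  for C :: "('o, 'm, 'z) tt_category_scheme" (structure) +
  assumes tno_obj: "\<lbrakk>a \<in> obj C; b \<in> obj C\<rbrakk> \<Longrightarrow> tno C a b \<in> obj C"
    and tna_Hom: "\<lbrakk>f \<in> Hom C a b; g \<in> Hom C c d\<rbrakk>
      \<Longrightarrow> tna C f g \<in> Hom C (tno C a c) (tno C b d)"
    and tna_idn: "\<lbrakk>a \<in> obj C; b \<in> obj C\<rbrakk>
      \<Longrightarrow> tna C (idn C a) (idn C b) = idn C (tno C a b)"
    and tna_cmp: "\<lbrakk>f \<in> Hom C a b; f' \<in> Hom C b c; g \<in> Hom C p q; g' \<in> Hom C q r\<rbrakk>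
      \<Longrightarrow> tna C (f' \<cdot> f) (g' \<cdot> g) = tna C f' g' \<cdot> tna C f g"
    and tunit_obj: "tunit C \<in> obj C"
    and assoc_Hom: "\<lbrakk>a \<in> obj C; b \<in> obj C; c \<in> obj C\<rbrakk>
      \<Longrightarrow> assoc C a b c \<in> Hom C (tno C (tno C a b) c) (tno C a (tno C b c))"
    and assoc_iso: "\<lbrakk>a \<in> obj C; b \<in> obj C; c \<in> obj C\<rbrakk> \<Longrightarrow> iso_arrow C (assoc C a b c)"
    and assoc_natural: "\<lbrakk>f \<in> Hom C a a'; g \<in> Hom C b b'; h \<in> Hom C c c'\<rbrakk>
      \<Longrightarrow> tna C f (tna C g h) \<cdot> assoc C a b c = assoc C a' b' c' \<cdot> tna C (tna C f g) h"
    and lunit_Hom: "a \<in> obj C \<Longrightarrow> lunit C a \<in> Hom C (tno C (tunit C) a) a"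
    and lunit_iso: "a \<in> obj C \<Longrightarrow> iso_arrow C (lunit C a)"
    and lunit_natural: "f \<in> Hom C a b
      \<Longrightarrow> f \<cdot> lunit C a = lunit C b \<cdot> tna C (idn C (tunit C)) f"
    and runit_Hom: "a \<in> obj C \<Longrightarrow> runit C a \<in> Hom C (tno C a (tunit C)) a"
    and runit_iso: "a \<in> obj C \<Longrightarrow> iso_arrow C (runit C a)"
    and runit_natural: "f \<in> Hom C a b
      \<Longrightarrow> f \<cdot> runit C a = runit C b \<cdot> tna C f (idn C (tunit C))"
    and braid_Hom: "\<lbrakk>a \<in> obj C; b \<in> obj C\<rbrakk> \<Longrightarrow> braid C a b \<in> Hom C (tno C a b) (tno C b a)"
    and braid_natural: "\<lbrakk>f \<in> Hom C a a'; g \<in> Hom C b b'\<rbrakk>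
      \<Longrightarrow> tna C g f \<cdot> braid C a b = braid C a' b' \<cdot> tna C f g"
    and braid_symmetric: "\<lbrakk>a \<in> obj C; b \<in> obj C\<rbrakk>
      \<Longrightarrow> braid C b a \<cdot> braid C a b = idn C (tno C a b)"
    and pentagon: "\<lbrakk>a \<in> obj C; b \<in> obj C; c \<in> obj C; d \<in> obj C\<rbrakk>
      \<Longrightarrow> assoc C a b (tno C c d) \<cdot> assoc C (tno C a b) c d =
          tna C (idn C a) (assoc C b c d) \<cdot> assoc C a (tno C b c) d \<cdot>
            tna C (assoc C a b c) (idn C d)"
    and unit_coherence: "\<lbrakk>a \<in> obj C; b \<in> obj C\<rbrakk>
      \<Longrightarrow> tna C (idn C a) (lunit C b) \<cdot> assoc C a (tunit C) b = tna C (runit C a) (idn C b)"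
    and hexagon: "\<lbrakk>a \<in> obj C; b \<in> obj C; c \<in> obj C\<rbrakk>
      \<Longrightarrow> assoc C b c a \<cdot> braid C a (tno C b c) \<cdot> assoc C a b c =
          tna C (idn C b) (braid C a c) \<cdot> assoc C b a c \<cdot> tna C (braid C a b) (idn C c)"

text \<open>The structure isomorphisms of a (strong) monoidal functor \<open>F\<close> are
  \<open>muc F a b : F(a) \<otimes> F(b) \<rightarrow> F(a \<otimes> b)\<close> and \<open>unc F : \<one> \<rightarrow> F(\<one>)\<close>.\<close>

record ('o, 'm, 'p, 'n) mon_func = "('o, 'm, 'p, 'n) ex_func" +
  muc :: "'o \<Rightarrow> 'o \<Rightarrow> 'n"
  unc :: "'n"

locale symmetric_monoidal_functor = cat_functor C D F +
    dom: symmetric_monoidal_category C + cod: symmetric_monoidal_category D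
  for C :: "('o, 'm, 'y) tt_category_scheme" and D :: "('p, 'n, 'z) tt_category_scheme"
    and F :: "('o, 'm, 'p, 'n, 'w) mon_func_scheme" +
  assumes muc_Hom: "\<lbrakk>a \<in> obj C; b \<in> obj C\<rbrakk>
      \<Longrightarrow> muc F a b \<in> Hom D (tno D (fob F a) (fob F b)) (fob F (tno C a b))"
    and muc_iso: "\<lbrakk>a \<in> obj C; b \<in> obj C\<rbrakk> \<Longrightarrow> iso_arrow D (muc F a b)"
    and muc_natural: "\<lbrakk>f \<in> Hom C a a'; g \<in> Hom C b b'\<rbrakk>
      \<Longrightarrow> far F (tna C f g) \<cdot>\<^bsub>D\<^esub> muc F a b = muc F a' b' \<cdot>\<^bsub>D\<^esub> tna D (far F f) (far F g)"
    and unc_Hom: "unc F \<in> Hom D (tunit D) (fob F (tunit C))"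
    and unc_iso: "iso_arrow D (unc F)"
    and far_assoc: "\<lbrakk>a \<in> obj C; b \<in> obj C; c \<in> obj C\<rbrakk>
      \<Longrightarrow> far F (assoc C a b c) \<cdot>\<^bsub>D\<^esub> muc F (tno C a b) c \<cdot>\<^bsub>D\<^esub> tna D (muc F a b) (idn D (fob F c)) =
          muc F a (tno C b c) \<cdot>\<^bsub>D\<^esub> tna D (idn D (fob F a)) (muc F b c) \<cdot>\<^bsub>D\<^esub>
            assoc D (fob F a) (fob F b) (fob F c)"
    and far_lunit: "a \<in> obj C
      \<Longrightarrow> far F (lunit C a) \<cdot>\<^bsub>D\<^esub> muc F (tunit C) a \<cdot>\<^bsub>D\<^esub> tna D (unc F) (idn D (fob F a)) =
          lunit D (fob F a)"
    and far_runit: "a \<in> obj C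
      \<Longrightarrow> far F (runit C a) \<cdot>\<^bsub>D\<^esub> muc F a (tunit C) \<cdot>\<^bsub>D\<^esub> tna D (idn D (fob F a)) (unc F) =
          runit D (fob F a)"
    and far_braid: "\<lbrakk>a \<in> obj C; b \<in> obj C\<rbrakk>
      \<Longrightarrow> far F (braid C a b) \<cdot>\<^bsub>D\<^esub> muc F a b = muc F b a \<cdot>\<^bsub>D\<^esub> braid D (fob F a) (fob F b)"


section \<open>Spaces and coefficient categories\<close>

text \<open>The kind of spaces (schemes, stacks, analytic spaces, ...) is left open: spaces are the objects
  of a category with an underlying topological space functor, a set of regular points in every
  space, and two classes of morphisms called closed and open immersions.\<close>

record ('x, 'f, 'p) geometry = "('x, 'f) category" +
  top_of :: "'x \<Rightarrow> 'p topology"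
  map_of :: "'f \<Rightarrow> 'p \<Rightarrow> 'p"
  regular :: "'x \<Rightarrow> 'p set"
  closed_imm :: "'f set"
  open_imm :: "'f set"

locale geometry = category Sp
  for Sp :: "('x, 'f, 'p, 'z) geometry_scheme" (structure) +
  assumes map_of_continuous: "f \<in> Hom Sp X Y
      \<Longrightarrow> continuous_map (top_of Sp X) (top_of Sp Y) (map_of Sp f)"
    and map_of_idn: "\<lbrakk>X \<in> obj Sp; p \<in> topspace (top_of Sp X)\<rbrakk> \<Longrightarrow> map_of Sp (idn Sp X) p = p"
    and map_of_cmp: "\<lbrakk>f \<in> Hom Sp X Y; g \<in> Hom Sp Y W; p \<in> topspace (top_of Sp X)\<rbrakk>
      \<Longrightarrow> map_of Sp (g \<cdot> f) p = map_of Sp g (map_of Sp f p)"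
    and regular_subset: "X \<in> obj Sp \<Longrightarrow> regular Sp X \<subseteq> topspace (top_of Sp X)"
    and closed_imm_arr: "closed_imm Sp \<subseteq> arr Sp"
    and open_imm_arr: "open_imm Sp \<subseteq> arr Sp"
    and closed_imm_embedding: "\<lbrakk>f \<in> closed_imm Sp; f \<in> Hom Sp X Y\<rbrakk>
      \<Longrightarrow> embedding_map (top_of Sp X) (top_of Sp Y) (map_of Sp f) \<and>
          closed_map (top_of Sp X) (top_of Sp Y) (map_of Sp f)"
    and open_imm_embedding: "\<lbrakk>f \<in> open_imm Sp; f \<in> Hom Sp X Y\<rbrakk>
      \<Longrightarrow> embedding_map (top_of Sp X) (top_of Sp Y) (map_of Sp f) \<and>
          open_map (top_of Sp X) (top_of Sp Y) (map_of Sp f)"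

definition Sing :: "('x, 'f, 'p, 'z) geometry_scheme \<Rightarrow> 'x \<Rightarrow> 'p set"
  where "Sing Sp X = topspace (top_of Sp X) - regular Sp X"

definition singular :: "('x, 'f, 'p, 'z) geometry_scheme \<Rightarrow> 'x \<Rightarrow> bool"
  where "singular Sp X \<longleftrightarrow> X \<in> obj Sp \<and> Sing Sp X \<noteq> {}"

definition singular_immersion :: "('x, 'f, 'p, 'z) geometry_scheme \<Rightarrow> 'x \<Rightarrow> 'x \<Rightarrow> 'f \<Rightarrow> bool"
  where "singular_immersion Sp Z X i \<longleftrightarrow>
    i \<in> closed_imm Sp \<and> i \<in> Hom Sp Z X \<and> map_of Sp i ` topspace (top_of Sp Z) = Sing Sp X"

definition regular_immersion :: "('x, 'f, 'p, 'z) geometry_scheme \<Rightarrow> 'x \<Rightarrow> 'x \<Rightarrow> 'f \<Rightarrow> bool"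
  where "regular_immersion Sp U X j \<longleftrightarrow>
    j \<in> open_imm Sp \<and> j \<in> Hom Sp U X \<and> map_of Sp j ` topspace (top_of Sp U) = regular Sp X"

text \<open>\<open>dcat S X\<close> is the category attached to the space \<open>X\<close>; \<open>pull S f\<close> and \<open>push S f\<close> are \<open>f\<^sup>*\<close> and
  \<open>f\<^sub>*\<close>, and \<open>adj_unit S f\<close>, \<open>adj_counit S f\<close> are the unit and the counit of their adjunction.\<close>

record ('x, 'f, 'o, 'm) coefficients =
  dcat :: "'x \<Rightarrow> ('o, 'm) tt_category"
  pull :: "'f \<Rightarrow> ('o, 'm, 'o, 'm) mon_func"
  push :: "'f \<Rightarrow> ('o, 'm, 'o, 'm) ex_func"
  adj_unit :: "'f \<Rightarrow> 'o \<Rightarrow> 'm"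
  adj_counit :: "'f \<Rightarrow> 'o \<Rightarrow> 'm"

locale coefficient_system = category Sp
  for Sp :: "('x, 'f, 'z) category_scheme" +
  fixes S :: "('x, 'f, 'o, 'm) coefficients"
  assumes dcat_triangulated: "X \<in> obj Sp \<Longrightarrow> triangulated_category (dcat S X)"
    and dcat_monoidal: "X \<in> obj Sp \<Longrightarrow> symmetric_monoidal_category (dcat S X)"
    and pull_exact: "f \<in> Hom Sp X Y \<Longrightarrow> exact_functor (dcat S Y) (dcat S X) (pull S f)"
    and pull_monoidal: "f \<in> Hom Sp X Y
      \<Longrightarrow> symmetric_monoidal_functor (dcat S Y) (dcat S X) (pull S f)"
    and push_exact: "f \<in> Hom Sp X Y \<Longrightarrow> exact_functor (dcat S X) (dcat S Y) (push S f)"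
    and pull_push_adjunction: "f \<in> Hom Sp X Y
      \<Longrightarrow> adjunction (dcat S Y) (dcat S X) (pull S f) (push S f) (adj_unit S f) (adj_counit S f)"

text \<open>The part of a recollement which is not given by \<open>i\<^sup>*, i\<^sub>*, j\<^sup>*, j\<^sub>*\<close>: the functors
  \<open>i\<^sup>!\<close> (\<open>shriek_i\<close>) and \<open>j\<^sub>!\<close> (\<open>shriek_j\<close>), the adjunctions \<open>i\<^sub>* \<stileturn> i\<^sup>!\<close> and \<open>j\<^sub>! \<stileturn> j\<^sup>*\<close>, and the
  connecting arrows \<open>bd_glue M : i\<^sub>*i\<^sup>*M \<rightarrow> j\<^sub>!j\<^sup>*M[1]\<close> and \<open>bd_loc M : j\<^sub>*j\<^sup>*M \<rightarrow> i\<^sub>*i\<^sup>!M[1]\<close>.\<close>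

record ('o, 'm) recollement_data =
  shriek_i :: "('o, 'm, 'o, 'm) func"
  shriek_j :: "('o, 'm, 'o, 'm) func"
  iunit :: "'o \<Rightarrow> 'm"
  icounit :: "'o \<Rightarrow> 'm"
  junit :: "'o \<Rightarrow> 'm"
  jcounit :: "'o \<Rightarrow> 'm"
  bd_glue :: "'o \<Rightarrow> 'm"
  bd_loc :: "'o \<Rightarrow> 'm"

locale recollement =
  fixes S :: "('x, 'f, 'o, 'm) coefficients"
    and Z X U :: 'x and i j :: 'f
    and R :: "('o, 'm) recollement_data"
  assumes i_shriek_adjunction:
      "adjunction (dcat S Z) (dcat S X) (push S i) (shriek_i R) (iunit R) (icounit R)"
    and j_shriek_adjunction:
      "adjunction (dcat S U) (dcat S X) (shriek_j R) (pull S j) (junit R) (jcounit R)"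
    and i_push_fully_faithful: "fully_faithful (dcat S Z) (dcat S X) (push S i)"
    and j_shriek_fully_faithful: "fully_faithful (dcat S U) (dcat S X) (shriek_j R)"
    and pull_j_push_i: "N \<in> obj (dcat S Z)
      \<Longrightarrow> zero_object (dcat S U) (fob (pull S j) (fob (push S i) N))"
    and pull_i_shriek_j: "N \<in> obj (dcat S U)
      \<Longrightarrow> zero_object (dcat S Z) (fob (pull S i) (fob (shriek_j R) N))"
    and bd_glue_natural: "nat_trans (dcat S X) (dcat S X) (push S i \<circ>\<^sub>F pull S i)
      (shift (dcat S X) 1 \<circ>\<^sub>F shriek_j R \<circ>\<^sub>F pull S j) (bd_glue R)"
    and glue_triangle: "M \<in> obj (dcat S X)
      \<Longrightarrow> (jcounit R M, adj_unit S i M, bd_glue R M) \<in> dtri (dcat S X)"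
    and bd_loc_natural: "nat_trans (dcat S X) (dcat S X) (push S j \<circ>\<^sub>F pull S j)
      (shift (dcat S X) 1 \<circ>\<^sub>F push S i \<circ>\<^sub>F shriek_i R) (bd_loc R)"
    and loc_triangle: "M \<in> obj (dcat S X)
      \<Longrightarrow> (icounit R M, adj_unit S j M, bd_loc R M) \<in> dtri (dcat S X)"


section \<open>Cohomology and the localisation sequence\<close>

definition coh :: "('x, 'f, 'o, 'm) coefficients \<Rightarrow> 'x \<Rightarrow> 'o \<Rightarrow> int \<Rightarrow> 'm monoid"
  where "coh S X A d = Hom_group (dcat S X) (tunit (dcat S X)) (sho (dcat S X) d A)"

definition coh_supp ::
    "('x, 'f, 'o, 'm) coefficients \<Rightarrow> ('o, 'm) recollement_data \<Rightarrow> 'x \<Rightarrow> 'f \<Rightarrow> 'o \<Rightarrow> int \<Rightarrow> 'm monoid"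
  where "coh_supp S R X i A = coh S X (fob (push S i) (fob (shriek_i R) A))"

definition forg ::
    "('x, 'f, 'o, 'm) coefficients \<Rightarrow> ('o, 'm) recollement_data \<Rightarrow> 'x \<Rightarrow> 'o \<Rightarrow> int \<Rightarrow> 'm \<Rightarrow> 'm"
  where "forg S R X A d a = sha (dcat S X) d (icounit R A) \<cdot>\<^bsub>dcat S X\<^esub> a"

text \<open>Restriction sends \<open>a : \<one> \<rightarrow> A[d]\<close> to \<open>\<one> \<cong> j\<^sup>*\<one> \<rightarrow> j\<^sup>*(A[d]) \<cong> (j\<^sup>*A)[d]\<close>.\<close>

definition restr :: "('x, 'f, 'o, 'm) coefficients \<Rightarrow> 'x \<Rightarrow> 'f \<Rightarrow> 'o \<Rightarrow> int \<Rightarrow> 'm \<Rightarrow> 'm"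
  where "restr S U j A d a =
    shc (pull S j) d A \<cdot>\<^bsub>dcat S U\<^esub> far (pull S j) a \<cdot>\<^bsub>dcat S U\<^esub> unc (pull S j)"

text \<open>The boundary sends \<open>b : \<one> \<rightarrow> (j\<^sup>*A)[d]\<close>, seen as an arrow \<open>j\<^sup>*\<one> \<rightarrow> (j\<^sup>*A)[d]\<close>, to its adjunct
  \<open>\<one> \<rightarrow> j\<^sub>*((j\<^sup>*A)[d]) \<cong> (j\<^sub>*j\<^sup>*A)[d]\<close> followed by the shifted connecting arrow to
  \<open>(i\<^sub>*i\<^sup>!A)[1][d] = (i\<^sub>*i\<^sup>!A)[d + 1]\<close>.  (Other sign conventions do not change its image.)\<close>

definition bdry ::
    "('x, 'f, 'o, 'm) coefficients \<Rightarrow> ('o, 'm) recollement_data \<Rightarrow>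
      'x \<Rightarrow> 'x \<Rightarrow> 'f \<Rightarrow> 'o \<Rightarrow> int \<Rightarrow> 'm \<Rightarrow> 'm"
  where "bdry S R X U j A d b =
    sha (dcat S X) d (bd_loc R A) \<cdot>\<^bsub>dcat S X\<^esub>
    shc (push S j) d (fob (pull S j) A) \<cdot>\<^bsub>dcat S X\<^esub>
    far (push S j) (b \<cdot>\<^bsub>dcat S U\<^esub> inv_arrow (dcat S U) (unc (pull S j))) \<cdot>\<^bsub>dcat S X\<^esub>
    adj_unit S j (tunit (dcat S X))"

text \<open>Graded cohomology \<open>H\<^sup>*\<close> is the direct sum of the \<open>H\<^sup>d\<close> over a set \<open>I\<close> of relevant degrees;
  an element is the family of its components, \<open>undefined\<close> off \<open>I\<close>.\<close>

definition gcoh :: "int set \<Rightarrow> ('x, 'f, 'o, 'm) coefficients \<Rightarrow> 'x \<Rightarrow> 'o \<Rightarrow> (int \<Rightarrow> 'm) monoid"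
  where "gcoh I S X A = sum_group I (coh S X A)"

definition gcoh_supp ::
    "int set \<Rightarrow> ('x, 'f, 'o, 'm) coefficients \<Rightarrow> ('o, 'm) recollement_data \<Rightarrow>
      'x \<Rightarrow> 'f \<Rightarrow> 'o \<Rightarrow> (int \<Rightarrow> 'm) monoid"
  where "gcoh_supp I S R X i A = sum_group I (coh_supp S R X i A)"

definition gforg ::
    "int set \<Rightarrow> ('x, 'f, 'o, 'm) coefficients \<Rightarrow> ('o, 'm) recollement_data \<Rightarrow>
      'x \<Rightarrow> 'o \<Rightarrow> (int \<Rightarrow> 'm) \<Rightarrow> (int \<Rightarrow> 'm)"
  where "gforg I S R X A a = (\<lambda>d\<in>I. forg S R X A d (a d))"

definition grestr ::
    "int set \<Rightarrow> ('x, 'f, 'o, 'm) coefficients \<Rightarrow> 'x \<Rightarrow> 'f \<Rightarrow> 'o \<Rightarrow> (int \<Rightarrow> 'm) \<Rightarrow> (int \<Rightarrow> 'm)"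
  where "grestr I S U j A a = (\<lambda>d\<in>I. restr S U j A d (a d))"

text \<open>The source of \<open>gbdry I\<close> is \<open>H\<^sup>*\<^sup>-\<^sup>1(U; j\<^sup>*A)\<close>, in the degrees \<open>d - 1\<close> for \<open>d\<close> in \<open>I\<close>.\<close>

definition gbdry ::
    "int set \<Rightarrow> ('x, 'f, 'o, 'm) coefficients \<Rightarrow> ('o, 'm) recollement_data \<Rightarrow>
      'x \<Rightarrow> 'x \<Rightarrow> 'f \<Rightarrow> 'o \<Rightarrow> (int \<Rightarrow> 'm) \<Rightarrow> (int \<Rightarrow> 'm)"
  where "gbdry I S R X U j A b = (\<lambda>d\<in>I. bdry S R X U j A (d - 1) (b (d - 1)))"


section \<open>Characteristic theories and the Milnor localisation torsor\<close>

text \<open>The class \<open>cls\<close> and the virtual (expected, Fulton-type) class \<open>vir\<close>.  Functoriality of the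
  theory is not required: only the two classes of a single space \<open>X\<close> matter below.\<close>

record ('x, 'm) char_theory =
  cls :: "'x \<Rightarrow> int \<Rightarrow> 'm"
  vir :: "'x \<Rightarrow> int \<Rightarrow> 'm"

definition char_theory_at ::
    "int set \<Rightarrow> ('x, 'f, 'o, 'm) coefficients \<Rightarrow> 'x \<Rightarrow> 'o \<Rightarrow> ('x, 'm) char_theory \<Rightarrow> bool"
  where "char_theory_at I S X A C \<longleftrightarrow>
    A \<in> obj (dcat S X) \<and> cls C X \<in> carrier (gcoh I S X A) \<and> vir C X \<in> carrier (gcoh I S X A)"

definition defect ::
    "int set \<Rightarrow> ('x, 'f, 'o, 'm) coefficients \<Rightarrow> 'x \<Rightarrow> 'o \<Rightarrow> ('x, 'm) char_theory \<Rightarrow> (int \<Rightarrow> 'm)"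
  where "defect I S X A C = vir C X \<otimes>\<^bsub>gcoh I S X A\<^esub> inv\<^bsub>gcoh I S X A\<^esub> (cls C X)"

definition Mil ::
    "int set \<Rightarrow> ('x, 'f, 'o, 'm) coefficients \<Rightarrow> ('o, 'm) recollement_data \<Rightarrow>
      'x \<Rightarrow> 'f \<Rightarrow> 'o \<Rightarrow> ('x, 'm) char_theory \<Rightarrow> (int \<Rightarrow> 'm) set"
  where "Mil I S R X i A C =
    {a \<in> carrier (gcoh_supp I S R X i A). gforg I S R X A a = defect I S X A C}"

definition boundary_group ::
    "int set \<Rightarrow> ('x, 'f, 'o, 'm) coefficients \<Rightarrow> ('o, 'm) recollement_data \<Rightarrow>
      'x \<Rightarrow> 'x \<Rightarrow> 'f \<Rightarrow> 'f \<Rightarrow> 'o \<Rightarrow> (int \<Rightarrow> 'm) monoid"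
  where "boundary_group I S R X U i j A = (gcoh_supp I S R X i A)
    \<lparr>carrier := gbdry I S R X U j A `
      carrier (gcoh ((\<lambda>d. d - 1) ` I) S U (fob (pull S j) A))\<rparr>"

definition torsor :: "('g, 'z) monoid_scheme \<Rightarrow> 'e set \<Rightarrow> ('g \<Rightarrow> 'e \<Rightarrow> 'e) \<Rightarrow> bool"
  where "torsor G E \<phi> \<longleftrightarrow>
    E \<noteq> {} \<and> group_action G E \<phi> \<and> (\<forall>x \<in> E. \<forall>y \<in> E. \<exists>!g. g \<in> carrier G \<and> \<phi> g x = y)"

text \<open>The restriction to \<open>E\<close> is imposed by \<open>BijGroup\<close>, whose elements are extensional.\<close>

definition translation :: "('g, 'z) monoid_scheme \<Rightarrow> 'g set \<Rightarrow> 'g \<Rightarrow> 'g \<Rightarrow> 'g"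
  where "translation H E g = (\<lambda>x\<in>E. g \<otimes>\<^bsub>H\<^esub> x)"

end

theory Submission
  imports Defs
begin

text \<open>In each degree the localisation sequence is \<open>Hom(\<one>, -)\<close> applied to the shifts of the triangle
  \<open>i\<^sub>*i\<^sup>!A \<rightarrow> A \<rightarrow> j\<^sub>*j\<^sup>*A\<close>.  Exactness at \<open>H\<^sup>*(X; A)\<close> lifts the defect, whose restriction to \<open>U\<close> vanishes,
  to a class with support.  The torsor is thus a nonempty fibre of the forgetful homomorphism, hence a
  coset of its kernel, and exactness at \<open>H\<^sup>*\<^sub>Z(X; A)\<close> identifies this kernel with the image of the
  boundary.  In the direct sum over the degrees, lifts are chosen to be zero wherever possible, so that
  they remain finitely supported.\<close>

section \<open>Exactness in triangulated categories\<close>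

lemma (in category) Hom_obj:
  assumes "f \<in> Hom C a b"
  shows "a \<in> obj C" "b \<in> obj C"
  using assms src_obj tgt_obj by (auto simp: Hom_def)

lemma (in category) inverse_arrows_unique:
  assumes g: "inverse_arrows C f g" and h: "inverse_arrows C f h"
  shows "g = h"
proof -
  have f: "f \<in> Hom C (src C f) (tgt C f)"
    using g by (simp add: inverse_arrows_def Hom_def)
  have "g = g \<cdot> (f \<cdot> h)"
    using g h cmp_idn_right[of g "tgt C f" "src C f"] by (simp add: inverse_arrows_def)
  also have "\<dots> = (g \<cdot> f) \<cdot> h"
    using g h f cmp_assoc[of h "tgt C f" "src C f" f "tgt C f" g "src C f"]
    by (simp add: inverse_arrows_def)
  also have "\<dots> = h"
    using g h cmp_idn_left[of h "tgt C f" "src C f"] by (simp add: inverse_arrows_def)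
  finally show ?thesis .
qed

lemma (in category) iso_arrow_inv:
  assumes "iso_arrow C f" and "f \<in> Hom C a b"
  shows "inv_arrow C f \<in> Hom C b a" "inv_arrow C f \<cdot> f = idn C a" "f \<cdot> inv_arrow C f = idn C b"
proof -
  obtain g where g: "inverse_arrows C f g"
    using assms(1) by (auto simp: iso_arrow_def)
  then have "inv_arrow C f = g"
    unfolding inv_arrow_def using inverse_arrows_unique by blast
  with g assms(2) show "inv_arrow C f \<in> Hom C b a" "inv_arrow C f \<cdot> f = idn C a"
    "f \<cdot> inv_arrow C f = idn C b"
    by (auto simp: inverse_arrows_def Hom_def)
qed

lemma (in category) inv_cmp_cancel:
  assumes "iso_arrow C f" and f: "f \<in> Hom C b c"
  shows "g \<in> Hom C a b \<Longrightarrow> inv_arrow C f \<cdot> (f \<cdot> g) = g"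
    and "g \<in> Hom C a c \<Longrightarrow> f \<cdot> (inv_arrow C f \<cdot> g) = g"
    and "g \<in> Hom C c d \<Longrightarrow> (g \<cdot> f) \<cdot> inv_arrow C f = g"
  using iso_arrow_inv[OF assms] cmp_idn_left[of g] cmp_idn_right[of g]
    cmp_assoc[of g a b f c "inv_arrow C f" b] cmp_assoc[of g a c "inv_arrow C f" b f c]
    cmp_assoc[of "inv_arrow C f" c b f c g d] f
  by simp_all

section \<open>Arrow groups and composition as a homomorphism\<close>

lemma Hom_group_simps [simp]:
  "carrier (Hom_group C a b) = Hom C a b"
  "mult (Hom_group C a b) = add C"
  "one (Hom_group C a b) = zer C a b"
  by (simp_all add: Hom_group_def)

context additive_category
begin

lemma Hom_group_group: "\<lbrakk>a \<in> obj C; b \<in> obj C\<rbrakk> \<Longrightarrow> group (Hom_group C a b)"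
  using Hom_comm_group by (rule comm_group.axioms(2))

lemma zer_Hom: "\<lbrakk>a \<in> obj C; b \<in> obj C\<rbrakk> \<Longrightarrow> zer C a b \<in> Hom C a b"
  using monoid.one_closed[OF group.is_monoid[OF Hom_group_group]] by simp

text \<open>Bilinearity of composition is packaged as a \<open>group_hom\<close>, so that the rules
  for zero arrows and negatives follow from general facts on homomorphisms.\<close>

lemma group_hom_cmp_left:
  assumes "g \<in> Hom C b c" "a \<in> obj C"
  shows "group_hom (Hom_group C a b) (Hom_group C a c) (\<lambda>f. g \<cdot> f)"
  using assms Hom_group_group Hom_obj[OF assms(1)] cmp_Hom
  unfolding group_hom_def group_hom_axioms_def hom_def
  by (simp add: cmp_add_right Pi_def)

lemma group_hom_cmp_right:
  assumes "f \<in> Hom C a b" "c \<in> obj C"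
  shows "group_hom (Hom_group C b c) (Hom_group C a c) (\<lambda>g. g \<cdot> f)"
  using assms Hom_group_group Hom_obj[OF assms(1)] cmp_Hom
  unfolding group_hom_def group_hom_axioms_def hom_def
  by (simp add: cmp_add_left Pi_def)

lemma cmp_zer_right: "\<lbrakk>g \<in> Hom C b c; a \<in> obj C\<rbrakk> \<Longrightarrow> g \<cdot> zer C a b = zer C a c"
  using group_hom.hom_one[OF group_hom_cmp_left] by simp

lemma cmp_zer_left: "\<lbrakk>f \<in> Hom C a b; c \<in> obj C\<rbrakk> \<Longrightarrow> zer C b c \<cdot> f = zer C a c"
  using group_hom.hom_one[OF group_hom_cmp_right] by simp

lemma neg_inv: "f \<in> Hom C a b \<Longrightarrow> neg C f = inv\<^bsub>Hom_group C a b\<^esub> f"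
  by (simp add: neg_def Hom_def)

lemma neg_Hom: "f \<in> Hom C a b \<Longrightarrow> neg C f \<in> Hom C a b"
  using group.inv_closed[OF Hom_group_group[of a b], of f] Hom_obj[of f a b] by (simp add: neg_inv)

lemma neg_neg: "f \<in> Hom C a b \<Longrightarrow> neg C (neg C f) = f"
  using group.inv_inv[OF Hom_group_group[of a b], of f] Hom_obj[of f a b] neg_Hom[of f a b]
  by (simp add: neg_inv)

lemma neg_zer: "\<lbrakk>a \<in> obj C; b \<in> obj C\<rbrakk> \<Longrightarrow> neg C (zer C a b) = zer C a b"
  using monoid.inv_one[OF group.is_monoid[OF Hom_group_group[of a b]]] neg_inv[OF zer_Hom[of a b]]
  by simp

lemma cmp_neg_left:
  assumes "f \<in> Hom C a b" "g \<in> Hom C b c"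
  shows "neg C g \<cdot> f = neg C (g \<cdot> f)"
  using group_hom.hom_inv[OF group_hom_cmp_right[of f a b c], of g] assms Hom_obj[of g b c]
    neg_inv[of g b c] neg_inv[OF cmp_Hom[OF assms]] by simp

lemma cmp_neg_right:
  assumes "f \<in> Hom C a b" "g \<in> Hom C b c"
  shows "g \<cdot> neg C f = neg C (g \<cdot> f)"
  using group_hom.hom_inv[OF group_hom_cmp_left[of g b c a], of f] assms Hom_obj[of f a b]
    neg_inv[of f a b] neg_inv[OF cmp_Hom[OF assms]] by simp

end

lemma (in additive_functor) group_hom_far:
  assumes "a \<in> obj C" "b \<in> obj C"
  shows "group_hom (Hom_group C a b) (Hom_group D (fob F a) (fob F b)) (far F)"
  using assms dom.Hom_group_group cod.Hom_group_group far_Hom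
  unfolding group_hom_def group_hom_axioms_def hom_def
  by (simp add: far_add fob_obj Pi_def)

lemma (in additive_functor) far_zer:
  "\<lbrakk>a \<in> obj C; b \<in> obj C\<rbrakk> \<Longrightarrow> far F (zer C a b) = zer D (fob F a) (fob F b)"
  using group_hom.hom_one[OF group_hom_far] by simp

lemma (in additive_functor) far_neg: "f \<in> Hom C a b \<Longrightarrow> far F (neg C f) = neg D (far F f)"
  using group_hom.hom_inv[OF group_hom_far[of a b], of f] dom.Hom_obj[of f a b]
    dom.neg_inv[of f a b] cod.neg_inv[OF far_Hom[of f a b]] by simp

section \<open>Shifts, and exactness of Hom(w, -) on distinguished triangles\<close>

context triangulated_category
begin

lemma sho_obj: "a \<in> obj C \<Longrightarrow> sho C n a \<in> obj C"
  using cat_functor.fob_obj[OF additive_functor.axioms(1)[OF shift_additive[of n]]]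
  by (simp add: shift_def)

lemma sha_Hom: "f \<in> Hom C a b \<Longrightarrow> sha C n f \<in> Hom C (sho C n a) (sho C n b)"
  using cat_functor.far_Hom[OF additive_functor.axioms(1)[OF shift_additive[of n]]]
  by (simp add: shift_def)

lemma sha_cmp: "\<lbrakk>f \<in> Hom C a b; g \<in> Hom C b c\<rbrakk> \<Longrightarrow> sha C n (g \<cdot> f) = sha C n g \<cdot> sha C n f"
  using cat_functor.far_cmp[OF additive_functor.axioms(1)[OF shift_additive[of n]]]
  by (simp add: shift_def)

lemma sha_idn: "a \<in> obj C \<Longrightarrow> sha C n (idn C a) = idn C (sho C n a)"
  using cat_functor.far_idn[OF additive_functor.axioms(1)[OF shift_additive[of n]]]
  by (simp add: shift_def)

lemma sha_zer: "\<lbrakk>a \<in> obj C; b \<in> obj C\<rbrakk> \<Longrightarrow> sha C n (zer C a b) = zer C (sho C n a) (sho C n b)"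
  using additive_functor.far_zer[OF shift_additive[of n]] by (simp add: shift_def)

lemma sha_neg: "f \<in> Hom C a b \<Longrightarrow> sha C n (neg C f) = neg C (sha C n f)"
  using additive_functor.far_neg[OF shift_additive[of n]] by (simp add: shift_def)

lemma sho_cancel: "a \<in> obj C \<Longrightarrow> sho C (- n) (sho C n a) = a"
  "a \<in> obj C \<Longrightarrow> sho C n (sho C (- n) a) = a"
  using sho_add[of a "- n" n] sho_add[of a n "- n"] sho_zero by auto

lemma sha_cancel: "f \<in> Hom C a b \<Longrightarrow> sha C (- n) (sha C n f) = f"
  "f \<in> Hom C a b \<Longrightarrow> sha C n (sha C (- n) f) = f"
  using sha_add[of f "- n" n] sha_add[of f n "- n"] sha_zero[of f] by (auto simp: Hom_def)

text \<open>TR3 with the vertices named, which trades the \<open>src\<close> and \<open>tgt\<close>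
  bookkeeping of \<open>triangle_map\<close> for explicit types of the arrows.\<close>

lemma dtri_map_extend:
  assumes d: "(f, g, h) \<in> dtri C" "(f', g', h') \<in> dtri C"
    and t: "triangle C x y z f g h" "triangle C x' y' z' f' g' h'"
    and uv: "u \<in> Hom C x x'" "v \<in> Hom C y y'" "v \<cdot> f = f' \<cdot> u"
  shows "\<exists>k \<in> Hom C z z'. k \<cdot> g = g' \<cdot> v \<and> sha C 1 u \<cdot> h = h' \<cdot> k"
proof -
  have s: "src C f = x" "tgt C f = y" "src C h = z" "src C f' = x'" "tgt C f' = y'" "src C h' = z'"
    using t by (simp_all add: triangle_def Hom_def)
  have "\<exists>k. triangle_map C (f, g, h) (f', g', h') u v k"
    by (rule TR3[OF d]) (use uv s in simp_all)
  then show ?thesis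
    by (auto simp: triangle_map_def s)
qed

lemma dtri_rotate:
  assumes d: "(f, g, h) \<in> dtri C" and t: "triangle C x y z f g h"
  shows "(g, h, neg C (sha C 1 f)) \<in> dtri C" "triangle C y z (sho C 1 x) g h (neg C (sha C 1 f))"
proof -
  show "(g, h, neg C (sha C 1 f)) \<in> dtri C"
    using TR2[OF t] d by blast
  show "triangle C y z (sho C 1 x) g h (neg C (sha C 1 f))"
    using t neg_Hom[OF sha_Hom[of f x y 1]] by (simp add: triangle_def)
qed

text \<open>Map the rotation of the triangle \<open>w \<rightarrow> w \<rightarrow> 0\<close> to the
  rotation of the given triangle; TR3 then fills in a shift of the required lift.\<close>

lemma dtri_exact_middle:
  assumes d: "(f, g, h) \<in> dtri C" and t: "triangle C x y z f g h"
    and a: "a \<in> Hom C w y" and ga: "g \<cdot> a = zer C w z"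
  shows "\<exists>b \<in> Hom C w x. a = f \<cdot> b"
proof -
  obtain o' where o': "zero_object C o'"
    using ex_zero_object by blast
  then have oo: "o' \<in> obj C"
    by (simp add: zero_object_def)
  have f: "f \<in> Hom C x y" and g: "g \<in> Hom C y z"
    using t by (auto simp: triangle_def)
  have w: "w \<in> obj C" and z: "z \<in> obj C"
    using Hom_obj[OF a] Hom_obj[OF g] by auto
  note zs = zer_Hom[OF w oo] zer_Hom[OF oo sho_obj[OF w, of 1]] zer_Hom[OF oo z]
  have t1: "triangle C w w o' (idn C w) (zer C w o') (zer C o' (sho C 1 w))"
    using idn_Hom[OF w] zs by (simp add: triangle_def)
  note r1 = dtri_rotate[OF TR1_idn[OF w o'] t1] and r2 = dtri_rotate[OF d t]
  \<comment> \<open>The square that TR3 requires: \<open>g \<cdot> a\<close> vanishes by assumption,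
    and the other composite passes through a zero object.\<close>
  have "zer C o' z \<cdot> zer C w o' = g \<cdot> a"
    using cmp_zer_right[OF zs(3) w] ga by simp
  then obtain k where k: "k \<in> Hom C (sho C 1 w) (sho C 1 x)"
    and eq: "sha C 1 a \<cdot> neg C (sha C 1 (idn C w)) = neg C (sha C 1 f) \<cdot> k"
    using dtri_map_extend[OF r1(1) r2(1) r1(2) r2(2) a zs(3)] by blast
  note sa = sha_Hom[OF a, of 1] and sf = sha_Hom[OF f, of 1]
  \<comment> \<open>The last square carries a minus sign from each of the two rotations, and they
    cancel.\<close>
  have "neg C (sha C 1 a) = neg C (sha C 1 f \<cdot> k)"
    using eq cmp_neg_left[OF k sf] cmp_neg_right[OF idn_Hom[OF sho_obj[OF w, of 1]] sa]
      cmp_idn_right[OF sa] sha_idn[OF w, of 1] by simp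
  then have "sha C 1 a = sha C 1 f \<cdot> k"
    using neg_neg[OF sa] neg_neg[OF cmp_Hom[OF k sf]] by metis
  then have "sha C (- 1) (sha C 1 a) = sha C (- 1) (sha C 1 f) \<cdot> sha C (- 1) k"
    using sha_cmp[OF k sf, of "- 1"] by simp
  then have "a = f \<cdot> sha C (- 1) k"
    by (simp only: sha_cancel(1)[OF a] sha_cancel(1)[OF f])
  moreover have "sha C (- 1) k \<in> Hom C w x"
    using sha_Hom[OF k, of "- 1"] sho_cancel(1)[OF w, of 1] sho_cancel(1)[of x 1] Hom_obj[OF f]
    by simp
  ultimately show ?thesis
    by blast
qed

text \<open>Shifts act strictly and invertibly, so a question about \<open>w\<close> and
  \<open>y[n]\<close> becomes one about \<open>w[-n]\<close> and \<open>y\<close>. This avoids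
  shifting the triangle itself, which for odd \<open>n\<close> would need a change of sign to stay
  distinguished.\<close>

lemma dtri_exact_middle_shift:
  assumes d: "(f, g, h) \<in> dtri C" and t: "triangle C x y z f g h"
    and a: "a \<in> Hom C w (sho C n y)" and ga: "sha C n g \<cdot> a = zer C w (sho C n z)"
  shows "\<exists>b \<in> Hom C w (sho C n x). a = sha C n f \<cdot> b"
proof -
  have f: "f \<in> Hom C x y" and g: "g \<in> Hom C y z"
    using t by (auto simp: triangle_def)
  have w: "w \<in> obj C" and x: "x \<in> obj C" and y: "y \<in> obj C" and z: "z \<in> obj C"
    using Hom_obj[OF a] Hom_obj[OF f] Hom_obj[OF g] by auto
  have a': "sha C (- n) a \<in> Hom C (sho C (- n) w) y"
    using sha_Hom[OF a, of "- n"] sho_cancel(1)[OF y, of n] by simp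
  have "g \<cdot> sha C (- n) a = sha C (- n) (sha C n g \<cdot> a)"
    using sha_cmp[OF a sha_Hom[OF g], of "- n"] sha_cancel(1)[OF g] by simp
  also have "\<dots> = zer C (sho C (- n) w) z"
    using sha_zer[OF w sho_obj[OF z], of "- n"] sho_cancel(1)[OF z] by (simp add: ga)
  finally obtain b where b: "b \<in> Hom C (sho C (- n) w) x" and ab: "sha C (- n) a = f \<cdot> b"
    using dtri_exact_middle[OF d t a'] by blast
  have "a = sha C n f \<cdot> sha C n b"
    using sha_cancel(2)[OF a, of n] sha_cmp[OF b f, of n] ab by simp
  moreover have "sha C n b \<in> Hom C w (sho C n x)"
    using sha_Hom[OF b, of n] sho_cancel(2)[OF w, of n] by simp
  ultimately show ?thesis
    by blast
qed

text \<open>Mapping the triangle on the identity of \<open>x\<close> to the given one, by the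
  identity and \<open>f\<close>, factors \<open>g \<cdot> f\<close> through a zero object.\<close>

lemma dtri_cmp_zer:
  assumes d: "(f, g, h) \<in> dtri C" and t: "triangle C x y z f g h"
  shows "g \<cdot> f = zer C x z"
proof -
  obtain o' where o': "zero_object C o'"
    using ex_zero_object by blast
  then have oo: "o' \<in> obj C"
    by (simp add: zero_object_def)
  have f: "f \<in> Hom C x y" and g: "g \<in> Hom C y z"
    using t by (auto simp: triangle_def)
  have x: "x \<in> obj C" and z: "z \<in> obj C"
    using Hom_obj[OF f] Hom_obj[OF g] by auto
  have t1: "triangle C x x o' (idn C x) (zer C x o') (zer C o' (sho C 1 x))"
    using idn_Hom[OF x] zer_Hom[OF x oo] zer_Hom[OF oo sho_obj[OF x, of 1]]
    by (simp add: triangle_def)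
  obtain k where k: "k \<in> Hom C o' z" "k \<cdot> zer C x o' = g \<cdot> f"
    using dtri_map_extend[OF TR1_idn[OF x o'] d t1 t idn_Hom[OF x] f refl] by blast
  then show ?thesis
    using cmp_zer_right[OF k(1) x] by simp
qed

text \<open>Two rotations make \<open>h\<close> and the negative of \<open>sha C 1 f\<close> the
  first two arrows of a triangle, so middle exactness applies; the sign does not change which arrows
  are annihilated.\<close>

lemma dtri_exact_right_shift:
  assumes d: "(f, g, h) \<in> dtri C" and t: "triangle C x y z f g h"
    and a: "a \<in> Hom C w (sho C (n + 1) x)"
  shows "sha C (n + 1) f \<cdot> a = zer C w (sho C (n + 1) y) \<longleftrightarrow>
    (\<exists>b \<in> Hom C w (sho C n z). a = sha C n h \<cdot> b)"
proof -
  have f: "f \<in> Hom C x y" and h: "h \<in> Hom C z (sho C 1 x)"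
    using t by (auto simp: triangle_def)
  have w: "w \<in> obj C" and x: "x \<in> obj C" and y: "y \<in> obj C" and z: "z \<in> obj C"
    using Hom_obj[OF a] Hom_obj[OF f] Hom_obj[OF h] by auto
  note t2 = dtri_rotate[OF dtri_rotate[OF d t]]
  have sf: "sha C n (sha C 1 f) = sha C (n + 1) f"
    using sha_add[of f n 1] f by (simp add: Hom_def)
  have so: "sho C n (sho C 1 x) = sho C (n + 1) x" "sho C n (sho C 1 y) = sho C (n + 1) y"
    using sho_add[OF x, of n 1] sho_add[OF y, of n 1] by auto
  have sf': "sha C (n + 1) f \<in> Hom C (sho C (n + 1) x) (sho C (n + 1) y)"
    by (rule sha_Hom[OF f])
  have nf: "sha C n (neg C (sha C 1 f)) = neg C (sha C (n + 1) f)"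
    using sha_neg[OF sha_Hom[OF f, of 1], of n] sf by simp
  show ?thesis
  proof
    assume "sha C (n + 1) f \<cdot> a = zer C w (sho C (n + 1) y)"
    then have "sha C n (neg C (sha C 1 f)) \<cdot> a = zer C w (sho C n (sho C 1 y))"
      using cmp_neg_left[OF a sf'] neg_zer[OF w sho_obj[OF y]] by (simp add: nf so)
    moreover have "a \<in> Hom C w (sho C n (sho C 1 x))"
      using a by (simp add: so)
    ultimately show "\<exists>b \<in> Hom C w (sho C n z). a = sha C n h \<cdot> b"
      by (intro dtri_exact_middle_shift[OF t2])
  next
    assume "\<exists>b \<in> Hom C w (sho C n z). a = sha C n h \<cdot> b"
    then obtain b where b: "b \<in> Hom C w (sho C n z)" and ab: "a = sha C n h \<cdot> b"
      by blast
    \<comment> \<open>For the converse, consecutive arrows of the twice rotated triangle compose to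
      zero.\<close>
    have "neg C (sha C 1 f) \<cdot> h = zer C z (sho C 1 y)"
      by (rule dtri_cmp_zer[OF t2])
    then have "neg C (sha C 1 f \<cdot> h) = zer C z (sho C 1 y)"
      using cmp_neg_left[OF h sha_Hom[OF f, of 1]] by simp
    then have "sha C 1 f \<cdot> h = zer C z (sho C 1 y)"
      using neg_neg[OF cmp_Hom[OF h sha_Hom[OF f, of 1]]] neg_zer[OF z sho_obj[OF y, of 1]]
      by metis
    then have "sha C (n + 1) f \<cdot> sha C n h = zer C (sho C n z) (sho C (n + 1) y)"
      using sha_cmp[OF h sha_Hom[OF f, of 1], of n] sha_zer[OF z sho_obj[OF y, of 1], of n]
      by (simp add: sf so)
    then show "sha C (n + 1) f \<cdot> a = zer C w (sho C (n + 1) y)"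
      using cmp_assoc[OF b sha_Hom[OF h, of n], of "sha C (n + 1) f"] sf' cmp_zer_left[OF b sho_obj[OF y]]
      by (simp add: ab so)
  qed
qed

end

section \<open>Fibres of group homomorphisms\<close>

text \<open>The image of \<open>a \<otimes> inv b\<close> is \<open>y\<close> times its own inverse,
  so points of a fibre differ by the kernel. The group may be noncommutative, so differences are
  taken on the side that matches left translation.\<close>

lemma (in group_hom) fibre_torsor:
  assumes y: "y \<in> h ` carrier G"
  defines "E \<equiv> {x \<in> carrier G. h x = y}"
  shows "torsor (G\<lparr>carrier := kernel G H h\<rparr>) E (translation G E)"
    and "\<lbrakk>a \<in> E; b \<in> E\<rbrakk> \<Longrightarrow> a \<otimes> inv b \<in> kernel G H h"
    and "\<lbrakk>a \<in> E; b \<in> E\<rbrakk> \<Longrightarrow> \<exists>!g. g \<in> kernel G H h \<and> a = g \<otimes> b"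
proof -
  let ?K = "kernel G H h"
  have E: "x \<in> carrier G" "h x = y" if "x \<in> E" for x
    using that by (auto simp: E_def)
  have K: "g \<in> carrier G" "h g = \<one>\<^bsub>H\<^esub>" if "g \<in> ?K" for g
    using that by (auto simp: kernel_def)
  have yH: "y \<in> carrier H"
    using y by auto
  have act: "g \<otimes> x \<in> E" if "g \<in> ?K" "x \<in> E" for g x
    using that E[OF that(2)] K[OF that(1)] yH by (simp add: E_def)
  show diff: "a \<otimes> inv b \<in> ?K" if "a \<in> E" "b \<in> E" for a b
    using that E[OF that(1)] E[OF that(2)] yH by (simp add: kernel_def)
  show unique: "\<exists>!g. g \<in> ?K \<and> a = g \<otimes> b" if "a \<in> E" "b \<in> E" for a b
  proof (rule ex1I[of _ "a \<otimes> inv b"])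
    show "a \<otimes> inv b \<in> ?K \<and> a = a \<otimes> inv b \<otimes> b"
      using that diff[OF that] E by (simp add: G.m_assoc)
    show "g = a \<otimes> inv b" if "g \<in> ?K \<and> a = g \<otimes> b" for g
      using that K[of g] E(1)[OF \<open>b \<in> E\<close>] by (simp add: G.m_assoc)
  qed
  have grp: "group (G\<lparr>carrier := ?K\<rparr>)"
    by (rule subgroup.subgroup_is_group[OF subgroup_kernel G.is_group])
  have bij: "translation G E g \<in> Bij E" if g: "g \<in> ?K" for g
  proof -
    \<comment> \<open>Translation by the inverse is the inverse bijection; the extensionality that
      \<open>Bij\<close> also demands is built into \<open>translation\<close>.\<close>
    have "inv g \<in> ?K"
      using subgroup.m_inv_closed[OF subgroup_kernel g] .
    then have "bij_betw (\<lambda>x. g \<otimes> x) E E"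
      using K(1)[OF g] E(1) act[OF g] act[of "inv g"]
      by (intro bij_betw_byWitness[where f' = "\<lambda>x. inv g \<otimes> x"])
        (auto simp: G.m_assoc[symmetric])
    then show ?thesis
      by (simp add: Bij_def translation_def)
  qed
  have "group_action (G\<lparr>carrier := ?K\<rparr>) E (translation G E)"
  proof (intro group_action.intro group_hom.intro group_hom_axioms.intro homI grp group_BijGroup)
    fix g g' assume "g \<in> carrier (G\<lparr>carrier := ?K\<rparr>)" "g' \<in> carrier (G\<lparr>carrier := ?K\<rparr>)"
    then have g: "g \<in> ?K" "g' \<in> ?K"
      by simp_all
    \<comment> \<open>The product of \<open>BijGroup\<close> is composition restricted to
      \<open>E\<close>; by \<open>act\<close> the intermediate point stays in
      \<open>E\<close>.\<close>
    have "translation G E (g \<otimes> g') = compose E (translation G E g) (translation G E g')"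
      using K(1)[OF g(1)] K(1)[OF g(2)] E(1) act[OF g(2)]
      by (auto simp: translation_def compose_def G.m_assoc)
    then show "translation G E (g \<otimes>\<^bsub>G\<lparr>carrier := ?K\<rparr>\<^esub> g') =
        translation G E g \<otimes>\<^bsub>BijGroup E\<^esub> translation G E g'"
      using bij[OF g(1)] bij[OF g(2)] by (simp add: BijGroup_def)
  qed (use bij in \<open>simp add: BijGroup_def\<close>)
  moreover have "E \<noteq> {}"
    using y by (auto simp: E_def)
  moreover have "\<exists>!g. g \<in> carrier (G\<lparr>carrier := ?K\<rparr>) \<and> translation G E g a = b"
    if "a \<in> E" "b \<in> E" for a b
    using unique[OF that(2,1)] that(1) by (simp add: translation_def eq_commute)
  ultimately show "torsor (G\<lparr>carrier := ?K\<rparr>) E (translation G E)"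
    by (simp add: torsor_def)
qed


section \<open>Degreewise maps of direct sums\<close>

text \<open>By \<open>f1\<close> a component of the image is nontrivial only where the source
  component is, and injectivity of \<open>s\<close> turns this into finite support. The reindexing
  \<open>s\<close> accommodates maps that change the degree.\<close>

lemma sum_group_map_closed:
  assumes G: "\<And>i. i \<in> I \<Longrightarrow> group (G (s i))" and H: "\<And>i. i \<in> I \<Longrightarrow> group (H i)"
    and f: "\<And>i x. \<lbrakk>i \<in> I; x \<in> carrier (G (s i))\<rbrakk> \<Longrightarrow> f i x \<in> carrier (H i)"
    and f1: "\<And>i. i \<in> I \<Longrightarrow> f i \<one>\<^bsub>G (s i)\<^esub> = \<one>\<^bsub>H i\<^esub>"
    and s: "inj_on s I" and x: "x \<in> carrier (sum_group (s ` I) G)"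
  shows "(\<lambda>i\<in>I. f i (x (s i))) \<in> carrier (sum_group I H)"
proof -
  have "x \<in> {x \<in> \<Pi>\<^sub>E k\<in>s ` I. carrier (G k). finite {k \<in> s ` I. x k \<noteq> \<one>\<^bsub>G k\<^esub>}}"
    using x carrier_sum_group[of "s ` I" G] G by auto
  then have x': "\<And>i. i \<in> I \<Longrightarrow> x (s i) \<in> carrier (G (s i))"
    and fin: "finite {k \<in> s ` I. x k \<noteq> \<one>\<^bsub>G k\<^esub>}"
    by auto
  have "s ` {i \<in> I. f i (x (s i)) \<noteq> \<one>\<^bsub>H i\<^esub>} \<subseteq> {k \<in> s ` I. x k \<noteq> \<one>\<^bsub>G k\<^esub>}"
    using f1 by auto
  then have "finite {i \<in> I. f i (x (s i)) \<noteq> \<one>\<^bsub>H i\<^esub>}"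
    using finite_imageD[OF finite_subset[OF _ fin] inj_on_subset[OF s]] by blast
  moreover have "{i \<in> I. (\<lambda>i\<in>I. f i (x (s i))) i \<noteq> \<one>\<^bsub>H i\<^esub>} = {i \<in> I. f i (x (s i)) \<noteq> \<one>\<^bsub>H i\<^esub>}"
    by auto
  ultimately show ?thesis
    using x' f carrier_sum_group[of I H] H by simp
qed

text \<open>Arbitrary preimages could destroy finite support; choosing the unit over every unit
  confines the support of the lift to that of \<open>y\<close>.\<close>

lemma sum_group_map_lift:
  assumes G: "\<And>i. i \<in> I \<Longrightarrow> group (G (s i))" and H: "\<And>i. i \<in> I \<Longrightarrow> group (H i)"
    and f1: "\<And>i. i \<in> I \<Longrightarrow> f i \<one>\<^bsub>G (s i)\<^esub> = \<one>\<^bsub>H i\<^esub>"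
    and s: "inj_on s I" and y: "y \<in> carrier (sum_group I H)"
    and im: "\<And>i. i \<in> I \<Longrightarrow> y i \<in> f i ` carrier (G (s i))"
  shows "\<exists>x \<in> carrier (sum_group (s ` I) G). (\<lambda>i\<in>I. f i (x (s i))) = y"
proof -
  have "\<exists>x. x \<in> carrier (G (s i)) \<and> f i x = y i \<and> (y i = \<one>\<^bsub>H i\<^esub> \<longrightarrow> x = \<one>\<^bsub>G (s i)\<^esub>)"
    if i: "i \<in> I" for i
  proof (cases "y i = \<one>\<^bsub>H i\<^esub>")
    case True
    with f1[OF i] show ?thesis
      using monoid.one_closed[OF group.is_monoid[OF G[OF i]]] by auto
  next
    case False
    then show ?thesis
      using im[OF i] by auto
  qed
  then obtain x where x: "\<And>i. i \<in> I \<Longrightarrow> x i \<in> carrier (G (s i))" "\<And>i. i \<in> I \<Longrightarrow> f i (x i) = y i"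
    "\<And>i. \<lbrakk>i \<in> I; y i = \<one>\<^bsub>H i\<^esub>\<rbrakk> \<Longrightarrow> x i = \<one>\<^bsub>G (s i)\<^esub>"
    by metis
  \<comment> \<open>The chosen family is transported along \<open>s\<close>; the restriction makes
    it extensional on the image of \<open>I\<close>.\<close>
  define x' where "x' = (\<lambda>k\<in>s ` I. x (the_inv_into I s k))"
  have x's: "x' (s i) = x i" if "i \<in> I" for i
    using that by (simp add: x'_def the_inv_into_f_f[OF s])
  have "{k \<in> s ` I. x' k \<noteq> \<one>\<^bsub>G k\<^esub>} \<subseteq> s ` {i \<in> I. y i \<noteq> \<one>\<^bsub>H i\<^esub>}"
    using x(3) x's by auto
  moreover have "finite {i \<in> I. y i \<noteq> \<one>\<^bsub>H i\<^esub>}"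
    using y using carrier_sum_group[of I H] H by simp
  ultimately have "finite {k \<in> s ` I. x' k \<noteq> \<one>\<^bsub>G k\<^esub>}"
    using finite_subset by blast
  moreover have "x' \<in> (\<Pi>\<^sub>E k\<in>s ` I. carrier (G k))"
    using x(1) x's by (auto simp: PiE_iff x'_def)
  ultimately have "x' \<in> carrier (sum_group (s ` I) G)"
    using carrier_sum_group[of "s ` I" G] G by blast
  moreover have "y \<in> extensional I"
    using y using carrier_sum_group[of I H] H by (simp add: PiE_iff)
  then have "(\<lambda>i\<in>I. f i (x' (s i))) = y"
    using x(2) x's by (auto simp: extensional_def)
  ultimately show ?thesis
    by blast
qed

lemma sum_group_map_hom:
  assumes f: "\<And>i. i \<in> I \<Longrightarrow> group_hom (G i) (H i) (f i)"
  shows "group_hom (sum_group I G) (sum_group I H) (\<lambda>x. \<lambda>i\<in>I. f i (x i))"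
proof -
  note f' = f[unfolded group_hom_def]
  have "(\<lambda>i\<in>I. f i (x i)) \<in> carrier (sum_group I H)" if "x \<in> carrier (sum_group I G)" for x
    using sum_group_map_closed[of I G "\<lambda>i. i" H f x] that f' group_hom.hom_closed[OF f]
      group_hom.hom_one[OF f] by simp
  moreover have "(\<lambda>i\<in>I. f i (x i \<otimes>\<^bsub>G i\<^esub> y i)) = (\<lambda>i\<in>I. f i (x i) \<otimes>\<^bsub>H i\<^esub> f i (y i))"
    if "x \<in> carrier (sum_group I G)" "y \<in> carrier (sum_group I G)" for x y
    using that f' by (intro restrict_ext) (auto simp: carrier_sum_group intro!: group_hom.hom_mult[OF f])
  ultimately show ?thesis
    using f' by (auto simp: group_hom_def group_hom_axioms_def hom_def cong: restrict_cong)
qed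


section \<open>The localisation sequence\<close>

lemma nat_trans_Hom:
  "\<lbrakk>nat_trans C D F G \<tau>; a \<in> obj C\<rbrakk> \<Longrightarrow> \<tau> a \<in> Hom D (fob F a) (fob G a)"
  by (simp add: nat_trans_def)

lemma nat_trans_natural:
  "\<lbrakk>nat_trans C D F G \<tau>; f \<in> Hom C a b\<rbrakk> \<Longrightarrow> far G f \<cdot>\<^bsub>D\<^esub> \<tau> a = \<tau> b \<cdot>\<^bsub>D\<^esub> far F f"
  by (simp add: nat_trans_def)

context adjunction
begin

lemma unit_Hom: "a \<in> obj C \<Longrightarrow> \<eta> a \<in> Hom C a (fob R (fob L a))"
  using nat_trans_Hom[OF unit_natural] by (simp add: comp_func_def id_func_def)

lemma counit_Hom: "b \<in> obj D \<Longrightarrow> \<epsilon> b \<in> Hom D (fob L (fob R b)) b"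
  using nat_trans_Hom[OF counit_natural] by (simp add: comp_func_def id_func_def)

text \<open>Naturality of the unit moves \<open>e\<close> past \<open>\<eta>\<close>, and a triangle
  identity removes what remains.\<close>

lemma adjunct_right:
  assumes e: "e \<in> Hom C a (fob R b)" and b: "b \<in> obj D"
  shows "far R (\<epsilon> b \<cdot>\<^bsub>D\<^esub> far L e) \<cdot>\<^bsub>C\<^esub> \<eta> a = e"
proof -
  note Le = left.far_Hom[OF e] and cb = counit_Hom[OF b]
  note RLe = right.far_Hom[OF Le] and Rcb = right.far_Hom[OF cb]
  have a: "a \<in> obj C"
    using left.dom.Hom_obj[OF e] by simp
  have "far R (\<epsilon> b \<cdot>\<^bsub>D\<^esub> far L e) \<cdot>\<^bsub>C\<^esub> \<eta> a = far R (\<epsilon> b) \<cdot>\<^bsub>C\<^esub> (far R (far L e) \<cdot>\<^bsub>C\<^esub> \<eta> a)"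
    using right.far_cmp[OF Le cb] left.dom.cmp_assoc[OF unit_Hom[OF a] RLe Rcb] by simp
  also have "far R (far L e) \<cdot>\<^bsub>C\<^esub> \<eta> a = \<eta> (fob R b) \<cdot>\<^bsub>C\<^esub> e"
    using nat_trans_natural[OF unit_natural e] by (simp add: comp_func_def id_func_def)
  also have "far R (\<epsilon> b) \<cdot>\<^bsub>C\<^esub> (\<eta> (fob R b) \<cdot>\<^bsub>C\<^esub> e) = e"
    using left.dom.cmp_assoc[OF e unit_Hom[OF right.fob_obj[OF b]] Rcb] triangle_right[OF b]
      left.dom.cmp_idn_left[OF e] by simp
  finally show ?thesis .
qed

text \<open>\<open>L\<close> need not be faithful, but an arrow into \<open>fob R b\<close> is
  determined by its adjunct, and the adjunct of the composite depends on \<open>u\<close> only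
  through \<open>far L u\<close>.\<close>

lemma far_left_eq_imp_eq:
  assumes u: "u \<in> Hom C a c" and v: "v \<in> Hom C a c" and eq: "far L u = far L v"
    and f: "f \<in> Hom C c (fob R b)" and b: "b \<in> obj D"
  shows "f \<cdot>\<^bsub>C\<^esub> u = f \<cdot>\<^bsub>C\<^esub> v"
proof -
  have "far L (f \<cdot>\<^bsub>C\<^esub> u) = far L (f \<cdot>\<^bsub>C\<^esub> v)"
    using left.far_cmp[OF u f] left.far_cmp[OF v f] eq by simp
  then show ?thesis
    using adjunct_right[OF left.dom.cmp_Hom[OF u f] b] adjunct_right[OF left.dom.cmp_Hom[OF v f] b]
    by metis
qed

end

section \<open>The localisation sequence in a single degree\<close>

locale localisation = coefficient_system Sp S + recollement S Z X U i j R
  for Sp :: "('x, 'f, 'z) category_scheme" and S :: "('x, 'f, 'o, 'm) coefficients"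
    and Z X U :: 'x and i j :: 'f and R :: "('o, 'm) recollement_data" +
  fixes A :: 'o
  assumes i_Hom: "i \<in> Hom Sp Z X" and j_Hom: "j \<in> Hom Sp U X" and A_obj: "A \<in> obj (dcat S X)"
begin

sublocale X: triangulated_category "dcat S X"
  by (rule dcat_triangulated[OF Hom_obj(2)[OF i_Hom]])

sublocale U: triangulated_category "dcat S U"
  by (rule dcat_triangulated[OF Hom_obj(1)[OF j_Hom]])

sublocale pull: exact_functor "dcat S X" "dcat S U" "pull S j"
  by (rule pull_exact[OF j_Hom])

sublocale push: exact_functor "dcat S U" "dcat S X" "push S j"
  by (rule push_exact[OF j_Hom])

text \<open>Provides the tensor units and the isomorphism \<open>unc\<close> from the unit on
  \<open>U\<close> to the pullback of the unit on \<open>X\<close>.\<close>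

sublocale unit: symmetric_monoidal_functor "dcat S X" "dcat S U" "pull S j"
  by (rule pull_monoidal[OF j_Hom])

sublocale adj: adjunction "dcat S X" "dcat S U" "pull S j" "push S j" "adj_unit S j" "adj_counit S j"
  by (rule pull_push_adjunction[OF j_Hom])

abbreviation "one_X \<equiv> tunit (dcat S X)"
abbreviation "one_U \<equiv> tunit (dcat S U)"
abbreviation "A_U \<equiv> fob (pull S j) A"
abbreviation "A_push \<equiv> fob (push S j) A_U"
abbreviation "A_supp \<equiv> fob (push S i) (fob (shriek_i R) A)"

lemma A_U_obj: "A_U \<in> obj (dcat S U)"
  by (rule pull.fob_obj[OF A_obj])

lemma loc_triangle_A:
  "triangle (dcat S X) A_supp A A_push (icounit R A) (adj_unit S j A) (bd_loc R A)"
  using adjunction.counit_Hom[OF i_shriek_adjunction A_obj] adj.unit_Hom[OF A_obj]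
    nat_trans_Hom[OF bd_loc_natural A_obj]
  by (simp add: triangle_def comp_func_def shift_def)

lemma A_supp_obj: "A_supp \<in> obj (dcat S X)"
  using loc_triangle_A X.Hom_obj(1)[of "icounit R A" A_supp A] by (simp add: triangle_def)

lemma shc_push: "shc (push S j) d A_U \<in> Hom (dcat S X) (fob (push S j) (sho (dcat S U) d A_U))
    (sho (dcat S X) d A_push)"
  using nat_trans_Hom[OF push.shc_natural A_U_obj] by (simp add: comp_func_def shift_def)

lemma shc_pull: "shc (pull S j) d A \<in> Hom (dcat S U) (fob (pull S j) (sho (dcat S X) d A))
    (sho (dcat S U) d A_U)"
  using nat_trans_Hom[OF pull.shc_natural A_obj] by (simp add: comp_func_def shift_def)

lemma carrier_coh: "carrier (coh S X A' d) = Hom (dcat S X) one_X (sho (dcat S X) d A')"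
  "carrier (coh S U A' d) = Hom (dcat S U) one_U (sho (dcat S U) d A')"
  "\<one>\<^bsub>coh S X A' d\<^esub> = zer (dcat S X) one_X (sho (dcat S X) d A')"
  "\<one>\<^bsub>coh S U A' d\<^esub> = zer (dcat S U) one_U (sho (dcat S U) d A')"
  by (simp_all add: coh_def)

lemma group_coh_X: "A' \<in> obj (dcat S X) \<Longrightarrow> group (coh S X A' d)"
  unfolding coh_def by (rule X.Hom_group_group[OF unit.dom.tunit_obj X.sho_obj])

lemma group_coh_U: "A' \<in> obj (dcat S U) \<Longrightarrow> group (coh S U A' d)"
  unfolding coh_def by (rule U.Hom_group_group[OF unit.cod.tunit_obj U.sho_obj])

lemma forg_hom: "group_hom (coh_supp S R X i A d) (coh S X A d) (forg S R X A d)"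
  unfolding coh_supp_def coh_def forg_def
  using X.group_hom_cmp_left[OF X.sha_Hom unit.dom.tunit_obj] loc_triangle_A
  by (simp add: triangle_def)

text \<open>Everything before the connecting arrow is isolated as a class with coefficients in
  \<open>A_push\<close>, the third vertex of the localisation triangle, where exactness can be
  applied.\<close>

lemma bdry_expand:
  assumes b: "b \<in> carrier (coh S U A_U d)"
  defines "c \<equiv> far (push S j) (b \<cdot>\<^bsub>dcat S U\<^esub> inv_arrow (dcat S U) (unc (pull S j)))
    \<cdot>\<^bsub>dcat S X\<^esub> adj_unit S j one_X"
  shows "bdry S R X U j A d b = sha (dcat S X) d (bd_loc R A) \<cdot>\<^bsub>dcat S X\<^esub>
      (shc (push S j) d A_U \<cdot>\<^bsub>dcat S X\<^esub> c)"
    and "shc (push S j) d A_U \<cdot>\<^bsub>dcat S X\<^esub> c \<in> carrier (coh S X A_push d)"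
proof -
  note inv = U.iso_arrow_inv(1)[OF unit.unc_iso unit.unc_Hom]
  have b': "b \<in> Hom (dcat S U) one_U (sho (dcat S U) d A_U)"
    using b by (simp add: carrier_coh)
  have c: "c \<in> Hom (dcat S X) one_X (fob (push S j) (sho (dcat S U) d A_U))"
    unfolding c_def
    by (rule X.cmp_Hom[OF adj.unit_Hom[OF unit.dom.tunit_obj] push.far_Hom[OF U.cmp_Hom[OF inv b']]])
  show "bdry S R X U j A d b = sha (dcat S X) d (bd_loc R A) \<cdot>\<^bsub>dcat S X\<^esub>
      (shc (push S j) d A_U \<cdot>\<^bsub>dcat S X\<^esub> c)"
    by (simp add: bdry_def c_def)
  show "shc (push S j) d A_U \<cdot>\<^bsub>dcat S X\<^esub> c \<in> carrier (coh S X A_push d)"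
    using X.cmp_Hom[OF c shc_push] by (simp add: carrier_coh)
qed

text \<open>Adjunction, together with the isomorphisms \<open>unc\<close> and \<open>shc\<close>,
  identifies the cohomology of \<open>U\<close> with that of \<open>X\<close> in
  \<open>A_push\<close>; the boundary then becomes composition with the shifted connecting
  arrow.\<close>

lemma bdry_image:
  "bdry S R X U j A d ` carrier (coh S U A_U d) =
    (\<lambda>e. sha (dcat S X) d (bd_loc R A) \<cdot>\<^bsub>dcat S X\<^esub> e) ` carrier (coh S X A_push d)"
proof (intro subset_antisym image_subsetI)
  fix b assume "b \<in> carrier (coh S U A_U d)"
  from bdry_expand[OF this] show "bdry S R X U j A d b \<in>
      (\<lambda>e. sha (dcat S X) d (bd_loc R A) \<cdot>\<^bsub>dcat S X\<^esub> e) ` carrier (coh S X A_push d)"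
    by blast
next
  fix e assume "e \<in> carrier (coh S X A_push d)"
  then have e: "e \<in> Hom (dcat S X) one_X (sho (dcat S X) d A_push)"
    by (simp add: carrier_coh)
  note iso = push.shc_iso[OF A_U_obj, of d]
  note W = U.sho_obj[OF A_U_obj, of d]
  \<comment> \<open>The preimage \<open>b\<close> of \<open>e\<close> is built backwards: undo
    \<open>shc\<close> to get \<open>k\<close>, take its adjunct \<open>g\<close>, then precompose
    with \<open>unc\<close> to start at the unit on \<open>U\<close>.\<close>
  define k where "k = inv_arrow (dcat S X) (shc (push S j) d A_U) \<cdot>\<^bsub>dcat S X\<^esub> e"
  have k: "k \<in> Hom (dcat S X) one_X (fob (push S j) (sho (dcat S U) d A_U))"
    unfolding k_def by (rule X.cmp_Hom[OF e X.iso_arrow_inv(1)[OF iso shc_push]])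
  define g where "g = adj_counit S j (sho (dcat S U) d A_U) \<cdot>\<^bsub>dcat S U\<^esub> far (pull S j) k"
  have g: "g \<in> Hom (dcat S U) (fob (pull S j) one_X) (sho (dcat S U) d A_U)"
    unfolding g_def by (rule U.cmp_Hom[OF pull.far_Hom[OF k] adj.counit_Hom[OF W]])
  define b where "b = g \<cdot>\<^bsub>dcat S U\<^esub> unc (pull S j)"
  have b: "b \<in> carrier (coh S U A_U d)"
    using U.cmp_Hom[OF unit.unc_Hom g] by (simp add: b_def carrier_coh)
  have "b \<cdot>\<^bsub>dcat S U\<^esub> inv_arrow (dcat S U) (unc (pull S j)) = g"
    unfolding b_def by (rule U.inv_cmp_cancel(3)[OF unit.unc_iso unit.unc_Hom g])
  then have "bdry S R X U j A d b = sha (dcat S X) d (bd_loc R A) \<cdot>\<^bsub>dcat S X\<^esub>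
      (shc (push S j) d A_U \<cdot>\<^bsub>dcat S X\<^esub> k)"
    using bdry_expand(1)[OF b] adj.adjunct_right[OF k W, folded g_def] by simp
  also have "shc (push S j) d A_U \<cdot>\<^bsub>dcat S X\<^esub> k = e"
    unfolding k_def by (rule X.inv_cmp_cancel(2)[OF iso shc_push e])
  finally have "bdry S R X U j A d b = sha (dcat S X) d (bd_loc R A) \<cdot>\<^bsub>dcat S X\<^esub> e" .
  then show "sha (dcat S X) d (bd_loc R A) \<cdot>\<^bsub>dcat S X\<^esub> e \<in>
      bdry S R X U j A d ` carrier (coh S U A_U d)"
    using b by (metis imageI)
qed

text \<open>Preservation of zero is what finite support of graded boundaries and of their lifts
  requires; the group structure on the image will come from its identification with a
  kernel.\<close>

lemma bdry_one: "bdry S R X U j A d \<one>\<^bsub>coh S U A_U d\<^esub> = \<one>\<^bsub>coh_supp S R X i A (d + 1)\<^esub>"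
proof -
  note inv = U.iso_arrow_inv(1)[OF unit.unc_iso unit.unc_Hom]
  note W = U.sho_obj[OF A_U_obj, of d]
  note one = unit.dom.tunit_obj
  note uno = pull.fob_obj[OF one]
  have bd: "bd_loc R A \<in> Hom (dcat S X) A_push (sho (dcat S X) 1 A_supp)"
    using loc_triangle_A by (simp add: triangle_def)
  have "zer (dcat S U) one_U (sho (dcat S U) d A_U) \<cdot>\<^bsub>dcat S U\<^esub>
      inv_arrow (dcat S U) (unc (pull S j)) = zer (dcat S U) (fob (pull S j) one_X) (sho (dcat S U) d A_U)"
    by (rule U.cmp_zer_left[OF inv W])
  moreover have "far (push S j) (zer (dcat S U) (fob (pull S j) one_X) (sho (dcat S U) d A_U)) =
      zer (dcat S X) (fob (push S j) (fob (pull S j) one_X)) (fob (push S j) (sho (dcat S U) d A_U))"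
    by (rule push.far_zer[OF uno W])
  ultimately show ?thesis
    using X.cmp_zer_left[OF adj.unit_Hom[OF one] push.fob_obj[OF W]]
      X.cmp_zer_right[OF shc_push[of d] one] X.cmp_zer_right[OF X.sha_Hom[OF bd, of d] one]
      X.sho_add[OF A_supp_obj, of d 1]
    by (simp add: bdry_def carrier_coh coh_supp_def)
qed

text \<open>Exactness at cohomology with support: \<open>bdry_image\<close> replaces the boundary by
  the connecting arrow, which the localisation triangle controls.\<close>

lemma bdry_image_kernel:
  assumes "a \<in> carrier (coh_supp S R X i A (d + 1))"
  shows "forg S R X A (d + 1) a = \<one>\<^bsub>coh S X A (d + 1)\<^esub> \<longleftrightarrow>
    a \<in> bdry S R X U j A d ` carrier (coh S U A_U d)"
  using X.dtri_exact_right_shift[OF loc_triangle[OF A_obj] loc_triangle_A, of a one_X d] assms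
  unfolding bdry_image by (auto simp: forg_def carrier_coh coh_supp_def)

lemma bdry_closed:
  assumes "b \<in> carrier (coh S U A_U d)"
  shows "bdry S R X U j A d b \<in> carrier (coh_supp S R X i A (d + 1))"
proof -
  have "sha (dcat S X) d (bd_loc R A) \<in>
      Hom (dcat S X) (sho (dcat S X) d A_push) (sho (dcat S X) (d + 1) A_supp)"
    using X.sha_Hom[of "bd_loc R A" _ _ d] loc_triangle_A X.sho_add[OF A_supp_obj, of d 1]
    by (simp add: triangle_def)
  then show ?thesis
    using bdry_expand[OF assms] X.cmp_Hom by (simp add: carrier_coh coh_supp_def)
qed

text \<open>The unit \<open>A \<rightarrow> j\<^sub>*j\<^sup>*A\<close> is not assumed to commute with the shifts, so its shift cannot be replaced
  by the unit at \<open>A[d]\<close>.  It suffices that its shift is, up to an isomorphism, an arrow into the image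
  of \<open>j\<^sub>*\<close>, hence its composite with \<open>a\<close> depends only on \<open>j\<^sup>*a\<close>.\<close>

lemma restr_eq_imp_forg:
  assumes "a \<in> carrier (coh S X A d)" "a' \<in> carrier (coh S X A d)"
    and eq: "restr S U j A d a = restr S U j A d a'"
  shows "a \<otimes>\<^bsub>coh S X A d\<^esub> inv\<^bsub>coh S X A d\<^esub> a' \<in> forg S R X A d ` carrier (coh_supp S R X i A d)"
proof -
  let ?XA = "sho (dcat S X) d A" and ?u = "sha (dcat S X) d (adj_unit S j A)"
  let ?s = "shc (push S j) d A_U"
  let ?k = "inv_arrow (dcat S X) ?s \<cdot>\<^bsub>dcat S X\<^esub> ?u"
  have a: "a \<in> Hom (dcat S X) one_X ?XA" "a' \<in> Hom (dcat S X) one_X ?XA"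
    using assms by (simp_all add: carrier_coh)
  note isopush = push.shc_iso[OF A_U_obj, of d] and isopull = pull.shc_iso[OF A_obj, of d]
  note W = U.sho_obj[OF A_U_obj, of d]
  have u: "?u \<in> Hom (dcat S X) ?XA (sho (dcat S X) d A_push)"
    by (rule X.sha_Hom[OF adj.unit_Hom[OF A_obj]])
  note inv = X.iso_arrow_inv(1)[OF isopush shc_push]
  note k = X.cmp_Hom[OF u inv]
  \<comment> \<open>The isomorphism \<open>shc\<close> is cancelled here and \<open>unc\<close>
    next, so equal restrictions give equal pullbacks.\<close>
  have pa: "far (pull S j) a \<cdot>\<^bsub>dcat S U\<^esub> unc (pull S j) = far (pull S j) a' \<cdot>\<^bsub>dcat S U\<^esub> unc (pull S j)"
    using U.inv_cmp_cancel(1)[OF isopull shc_pull U.cmp_Hom[OF unit.unc_Hom pull.far_Hom[OF a(1)]]]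
      U.inv_cmp_cancel(1)[OF isopull shc_pull U.cmp_Hom[OF unit.unc_Hom pull.far_Hom[OF a(2)]]] eq
    unfolding restr_def by metis
  have "far (pull S j) a = far (pull S j) a'"
    using U.inv_cmp_cancel(3)[OF unit.unc_iso unit.unc_Hom pull.far_Hom[OF a(1)]]
      U.inv_cmp_cancel(3)[OF unit.unc_iso unit.unc_Hom pull.far_Hom[OF a(2)]] pa by metis
  \<comment> \<open>The target of \<open>?k\<close> lies in the image of \<open>push S j\<close>, so
    its composite with \<open>a\<close> sees only the pullback of \<open>a\<close>.\<close>
  then have "?k \<cdot>\<^bsub>dcat S X\<^esub> a = ?k \<cdot>\<^bsub>dcat S X\<^esub> a'"
    by (rule adj.far_left_eq_imp_eq[OF a _ k W])
  then have "inv_arrow (dcat S X) ?s \<cdot>\<^bsub>dcat S X\<^esub> (?u \<cdot>\<^bsub>dcat S X\<^esub> a) =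
      inv_arrow (dcat S X) ?s \<cdot>\<^bsub>dcat S X\<^esub> (?u \<cdot>\<^bsub>dcat S X\<^esub> a')"
    using X.cmp_assoc[OF a(1) u inv] X.cmp_assoc[OF a(2) u inv] by simp
  then have ua: "?u \<cdot>\<^bsub>dcat S X\<^esub> a = ?u \<cdot>\<^bsub>dcat S X\<^esub> a'"
    using X.inv_cmp_cancel(2)[OF isopush shc_push X.cmp_Hom[OF a(1) u]]
      X.inv_cmp_cancel(2)[OF isopush shc_push X.cmp_Hom[OF a(2) u]] by metis
  let ?d = "a \<otimes>\<^bsub>coh S X A d\<^esub> inv\<^bsub>coh S X A d\<^esub> a'"
  interpret h: group_hom "coh S X A d" "coh S X A_push d" "\<lambda>f. ?u \<cdot>\<^bsub>dcat S X\<^esub> f"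
    unfolding coh_def by (rule X.group_hom_cmp_left[OF u unit.dom.tunit_obj])
  have d: "?d \<in> carrier (coh S X A d)"
    using assms by simp
  \<comment> \<open>Composition with \<open>?u\<close> is additive and agrees on \<open>a\<close>
    and \<open>a'\<close>; once it annihilates their difference, exactness at the middle vertex
    supplies the lift.\<close>
  have "?u \<cdot>\<^bsub>dcat S X\<^esub> ?d = \<one>\<^bsub>coh S X A_push d\<^esub>"
    using h.hom_mult[OF assms(1) h.G.inv_closed[OF assms(2)]] h.hom_inv[OF assms(2)] ua
      h.H.r_inv[OF h.hom_closed[OF assms(2)]] by simp
  then show ?thesis
    using X.dtri_exact_middle_shift[OF loc_triangle[OF A_obj] loc_triangle_A, of ?d one_X d] d
    by (auto simp: carrier_coh forg_def coh_supp_def)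
qed

section \<open>Passage to graded cohomology\<close>

lemma gforg_hom: "group_hom (gcoh_supp I S R X i A) (gcoh I S X A) (gforg I S R X A)"
  unfolding gcoh_supp_def gcoh_def gforg_def[abs_def] by (rule sum_group_map_hom[OF forg_hom])

text \<open>Degreewise exactness passes to direct sums because both boundaries and the chosen lifts
  stay finitely supported. As a kernel, the set of boundaries is automatically a subgroup.\<close>

lemma boundary_group_kernel:
  "boundary_group I S R X U i j A =
    (gcoh_supp I S R X i A)
      \<lparr>carrier := kernel (gcoh_supp I S R X i A) (gcoh I S X A) (gforg I S R X A)\<rparr>"
proof -
  let ?G = "coh S U A_U" and ?H = "coh_supp S R X i A"
  \<comment> \<open>The component in degree \<open>d\<close> comes from degree \<open>d - 1\<close>
    on \<open>U\<close>, so the source sum is indexed by the image of \<open>I\<close> under the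
    injection \<open>?s\<close>.\<close>
  let ?f = "\<lambda>d. bdry S R X U j A (d - 1)" and ?s = "\<lambda>d::int. d - 1"
  have G: "group (?G d)" for d
    by (rule group_coh_U[OF A_U_obj])
  have H: "group (?H d)" for d
    unfolding coh_supp_def by (rule group_coh_X[OF A_supp_obj])
  have s: "inj_on ?s I"
    by simp
  have f1: "?f d \<one>\<^bsub>?G (d - 1)\<^esub> = \<one>\<^bsub>?H d\<^esub>" for d
    using bdry_one[of "d - 1"] by simp
  have f: "?f d x \<in> carrier (?H d)" if "x \<in> carrier (?G (d - 1))" for d x
    using bdry_closed[OF that] by simp
  have ker: "forg S R X A d x = \<one>\<^bsub>coh S X A d\<^esub> \<longleftrightarrow> x \<in> ?f d ` carrier (?G (d - 1))"
    if "x \<in> carrier (?H d)" for d x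
    using bdry_image_kernel[of x "d - 1"] that by simp
  have "gbdry I S R X U j A ` carrier (sum_group (?s ` I) ?G) =
      kernel (gcoh_supp I S R X i A) (gcoh I S X A) (gforg I S R X A)"
  proof (intro subset_antisym image_subsetI subsetI)
    fix b assume b: "b \<in> carrier (sum_group (?s ` I) ?G)"
    have "b \<in> (\<Pi>\<^sub>E k\<in>?s ` I. carrier (?G k))"
      using b by (simp add: carrier_sum_group G)
    then have bc: "b (d - 1) \<in> carrier (?G (d - 1))" if "d \<in> I" for d
      using that by blast
    then have "forg S R X A d (?f d (b (d - 1))) = \<one>\<^bsub>coh S X A d\<^esub>" if "d \<in> I" for d
      using ker f that by blast
    then show "gbdry I S R X U j A b \<in> kernel (gcoh_supp I S R X i A) (gcoh I S X A) (gforg I S R X A)"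
      using sum_group_map_closed[where f = ?f and s = ?s, OF G H f f1 s b]
      by (simp add: kernel_def gbdry_def gforg_def gcoh_supp_def gcoh_def cong: restrict_cong)
  next
    fix y assume "y \<in> kernel (gcoh_supp I S R X i A) (gcoh I S X A) (gforg I S R X A)"
    then have y: "y \<in> carrier (sum_group I ?H)"
      and eq: "(\<lambda>d\<in>I. forg S R X A d (y d)) = (\<lambda>d\<in>I. \<one>\<^bsub>coh S X A d\<^esub>)"
      by (simp_all add: kernel_def gforg_def gcoh_supp_def gcoh_def)
    have "y \<in> (\<Pi>\<^sub>E d\<in>I. carrier (?H d))"
      using y by (simp add: carrier_sum_group H)
    then have "y d \<in> ?f d ` carrier (?G (d - 1))" if "d \<in> I" for d
      using ker[of "y d" d] fun_cong[OF eq, of d] that by (auto simp: PiE_iff)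
    from sum_group_map_lift[where f = ?f and s = ?s, OF G H f1 s y this]
    show "y \<in> gbdry I S R X U j A ` carrier (sum_group (?s ` I) ?G)"
      by (auto simp: gbdry_def)
  qed
  then show ?thesis
    by (simp add: boundary_group_def gcoh_def)
qed

text \<open>Agreement of the two restrictions is fed degree by degree to
  \<open>restr_eq_imp_forg\<close>, whose conclusion already concerns a difference of classes. The
  degreewise lifts are then assembled with finite support.\<close>

lemma defect_in_image_gforg:
  assumes C: "char_theory_at I S X A C"
    and eq: "grestr I S U j A (vir C X) = grestr I S U j A (cls C X)"
  shows "defect I S X A C \<in> gforg I S R X A ` carrier (gcoh_supp I S R X i A)"
proof -
  let ?G = "coh_supp S R X i A" and ?H = "coh S X A"
  have H: "group (?H d)" for d
    by (rule group_coh_X[OF A_obj])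
  have G: "group (?G d)" for d
    unfolding coh_supp_def by (rule group_coh_X[OF A_supp_obj])
  have c: "cls C X \<in> carrier (sum_group I ?H)" "vir C X \<in> carrier (sum_group I ?H)"
    using C by (simp_all add: char_theory_at_def gcoh_def)
  then have c': "cls C X d \<in> carrier (?H d)" "vir C X d \<in> carrier (?H d)" if "d \<in> I" for d
    using that by (auto simp: carrier_sum_group H)
  \<comment> \<open>Products and inverses in the direct sum are componentwise, so the defect can be
    lifted in each degree separately.\<close>
  have def_eq: "defect I S X A C = (\<lambda>d\<in>I. vir C X d \<otimes>\<^bsub>?H d\<^esub> inv\<^bsub>?H d\<^esub> (cls C X d))"
    using c(1) by (simp add: defect_def gcoh_def H cong: restrict_cong)
  have closed: "defect I S X A C \<in> carrier (sum_group I ?H)"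
    using group.inv_closed[OF sum_group[OF H] c(1)] c(2)
      monoid.m_closed[OF group.is_monoid[OF sum_group[OF H]], of "vir C X" I "\<lambda>d. d"]
    unfolding defect_def gcoh_def by blast
  have im: "defect I S X A C d \<in> forg S R X A d ` carrier (?G d)" if d: "d \<in> I" for d
    using restr_eq_imp_forg[OF c'(2,1)[OF d]] fun_cong[OF eq, of d] d
    by (simp add: def_eq grestr_def)
  have one: "forg S R X A d \<one>\<^bsub>?G d\<^esub> = \<one>\<^bsub>?H d\<^esub>" for d
    by (rule group_hom.hom_one[OF forg_hom])
  \<comment> \<open>The forgetful map preserves degrees, so here the reindexing is the
    identity.\<close>
  have "\<exists>a \<in> carrier (sum_group I ?G). (\<lambda>d\<in>I. forg S R X A d (a d)) = defect I S X A C"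
    using sum_group_map_lift[where f = "forg S R X A" and s = "\<lambda>d. d" and I = I, OF G H one _ closed im]
    by simp
  then show ?thesis
    unfolding gforg_def[abs_def] gcoh_supp_def by (simp add: image_iff eq_commute)
qed

end

theorem theorem10p9:
  fixes Sp :: "('x, 'f, 'p) geometry"
    and S :: "('x, 'f, 'o, 'm) coefficients"
    and R :: "('o, 'm) recollement_data"
    and X Z U :: 'x and i j :: 'f
    and A :: 'o
    and C :: "('x, 'm) char_theory"
    and I :: "int set"
  assumes "geometry Sp"
    and "coefficient_system Sp S"
    and "singular Sp X"
    and "singular_immersion Sp Z X i"
    and "regular_immersion Sp U X j"
    and "recollement S Z X U i j R"
    and "char_theory_at I S X A C"
    and "grestr I S U j A (vir C X) = grestr I S U j A (cls C X)"
  shows "Mil I S R X i A C \<noteq> {} \<and>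
    subgroup (carrier (boundary_group I S R X U i j A)) (gcoh_supp I S R X i A) \<and>
    torsor (boundary_group I S R X U i j A) (Mil I S R X i A C)
      (translation (gcoh_supp I S R X i A) (Mil I S R X i A C)) \<and>
    (\<forall>a\<^sub>1 \<in> Mil I S R X i A C. \<forall>a\<^sub>2 \<in> Mil I S R X i A C.
      a\<^sub>1 \<otimes>\<^bsub>gcoh_supp I S R X i A\<^esub> inv\<^bsub>gcoh_supp I S R X i A\<^esub> a\<^sub>2
        \<in> carrier (boundary_group I S R X U i j A) \<and>
      (\<exists>!g. g \<in> carrier (boundary_group I S R X U i j A) \<and>
        a\<^sub>1 = g \<otimes>\<^bsub>gcoh_supp I S R X i A\<^esub> a\<^sub>2))"
proof -
  have ij: "i \<in> Hom Sp Z X" "j \<in> Hom Sp U X"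
    using assms(4,5) by (simp_all add: singular_immersion_def regular_immersion_def)
  have A: "A \<in> obj (dcat S X)"
    using assms(7) by (simp add: char_theory_at_def)
  interpret L: localisation Sp S Z X U i j R A
    using assms(2,6) ij A by (intro localisation.intro localisation_axioms.intro)
  interpret F: group_hom "gcoh_supp I S R X i A" "gcoh I S X A" "gforg I S R X A"
    by (rule L.gforg_hom)
  note d = L.defect_in_image_gforg[OF assms(7,8)]
  \<comment> \<open>Folding \<open>Mil_def\<close> recognises the torsor as the fibre of the graded
    forgetful map over the defect, nonempty by the preceding fact.\<close>
  note tors = F.fibre_torsor[OF d, folded Mil_def]
  have "Mil I S R X i A C \<noteq> {}"
    using tors(1) by (simp add: torsor_def)
  \<comment> \<open>Once the boundary group is rewritten as the kernel of the forgetful map, its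
    subgroup property and the torsor claims are those of the fibre.\<close>
  then show ?thesis
    using tors F.subgroup_kernel unfolding L.boundary_group_kernel by simp
qed

end
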